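(* The map $\varphi:M\to\mathbb P^{80-1}$ is $G$-equivariant: $$g(\varphi(x))=\varphi(\iota(g)x),\qquad g\in G,\ x\in M,$$ that is, for every $g\in G$ there is a rational function $c_g$ in $(x_1,x_2,x_3,x_4)$ such that $$(gy_\alpha)(x)=c_g(x)\,y_\alpha(\iota(g)x),\qquad \alpha\in\pm\mathcal A,\ x=(x_1,x_2,x_3,x_4)\in M.$$
   Context: Everything is over $\mathbb C$. **The space $M$.** For $x=(x_1,x_2,x_3,x_4)\in\mathbb C^4$ also write $x$ for the $3\times 6$ matrix $$x=\begin{pmatrix}1&0&0&1&1&1\\0&1&0&1&x_1&x_2\\0&0&1&1&x_3&x_4\end{pmatrix}.$$ Put $D_1=x_1x_4-x_2x_3$, $D_2=x_1x_4-x_4+x_2-x_2x_3+x_3-x_1$, $Q=-x_1x_2x_3-x_2x_3x_4+x_2x_3+x_1x_2x_4+x_1x_3x_4-x_1x_4$, and $$D(x)=x_1x_2x_3x_4(x_1-1)(x_2-1)(x_3-1)(x_4-1)(x_1-x_2)(x_1-x_3)(x_2-x_4)(x_3-x_4)D_1D_2Q.$$ $M=\{x\in\mathbb C^4\mid D(x)\ne0\}$ is the moduli space of marked cubic surfaces: it is the space of $3\times6$ matrices whose columns give six points of $\mathbb P^2$, no three collinear and not all six on a conic, modulo $GL_3$ on the left and $(\mathbb C^\times)^6$ scaling the columns. **The group $\underline G$.** The following are biregular involutions of $M$: - $s_1(x)=\left(\frac1{x_1},\frac1{x_2},\frac{x_3}{x_1},\frac{x_4}{x_2}\right)$, - $s_2(x)=(x_3,x_4,x_1,x_2)$,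 - $s_3(x)=\left(\frac{x_1-x_3}{1-x_3},\frac{x_2-x_4}{1-x_4},\frac{x_3}{x_3-1},\frac{x_4}{x_4-1}\right)$, - $s_4(x)=\left(\frac1{x_1},\frac{x_2}{x_1},\frac1{x_3},\frac{x_4}{x_3}\right)$, - $s_5(x)=(x_2,x_1,x_4,x_3)$, - $s_6(x)=\left(\frac1{x_1},\frac1{x_2},\frac1{x_3},\frac1{x_4}\right)$. They generate a group $\underline G$ isomorphic to the Weyl group $W(E_6)$, with Coxeter graph the chain $s_1-s_2-s_3-s_4-s_5$ and $s_6$ attached to $s_3$. **Root system and the group $G$.** Let $\varepsilon_1,\dots,\varepsilon_8$ be an orthonormal basis of Euclidean $8$-space, $\tilde\varepsilon=\varepsilon_6-\varepsilon_7-\varepsilon_8$, and $E$ the span of $\varepsilon_1,\dots,\varepsilon_5,\tilde\varepsilon$. Put $r=-\frac12(\varepsilon_1+\cdots+\varepsilon_5+\tilde\varepsilon)$ and $r_0=\frac12(\varepsilon_1+\cdots+\varepsilon_5-\tilde\varepsilon)$; $r_{1j}=-\varepsilon_{j-1}+r_0$ for $2\le j\le6$; $r_{jk}=\varepsilon_{j-1}-\varepsilon_{k-1}$ and $r_{1jk}=-\varepsilon_{j-1}-\varepsilon_{k-1}$ for $2\le j<k\le6$; $r_{ijk}=-\varepsilon_{i-1}-\varepsilon_{j-1}-\varepsilon_{k-1}+r_0$ for $2\le i<j<k\le6$ (indices of $r_{ij}$, $r_{ijk}$ may be permuted freely). $\Delta=\{\pm r,\pm r_{ij},\pm r_{ijk}\}$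 is a root system of type $E_6$. Let $s_{ij},s_{ijk}$ be the reflections of $E$ in $r_{ij},r_{ijk}$, and $G=\langle s_{12},s_{23},s_{34},s_{45},s_{56},s_{123}\rangle\cong W(E_6)$. The isomorphism $\iota:G\to\underline G$ is given by $s_{12}\mapsto s_1$, $s_{23}\mapsto s_2$, $s_{34}\mapsto s_3$, $s_{45}\mapsto s_4$, $s_{56}\mapsto s_5$, $s_{123}\mapsto s_6$. **Labels.** $\mathcal A$ is the set of $40$ labels consisting of the $10$ labels $(abc,def)$ and the $30$ labels $(ab,cd,ef)$ with $\{a,b,c,d,e,f\}=\{1,\dots,6\}$, with identifications: in $(abc,def)$ the entries inside each triple may be permuted and the two triples interchanged; in $(ab,cd,ef)$ the entries inside each pair may be permuted and the three pairs may be cyclically permuted (but $(ab,cd,ef)\ne(ab,ef,cd)$). Labels correspond bijectively to unordered triples of mutually orthogonal $A_2$-subsystems of $\Delta$ spanning $E$: the label $(abc,def)$ corresponds to $$\{\pm r_{ab},\pm r_{bc},\pm r_{ac}\},\ \{\pm r_{de},\pm r_{ef},\pm r_{df}\},\ \{\pm r,\pm r_{abc},\pm r_{def}\},$$ and $(ab,cd,ef)$ corresponds to $$\{\pm r_{ab},\pm r_{acd},\pm r_{bcd}\},\ \{\pm r_{cd},\pm r_{cef},\pm r_{def}\},\ \{\pm r_{ef},\pm r_{abe},\pm r_{abf}\}.$$ Via this bijection $G$ acts on $\mathcal A$. **Action of $G$ on $\mathbb P^{80-1}$.** The homogeneous coordinates on $\mathbb P^{80-1}$ are $y_\alpha,y_{-\alpha}$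 ($\alpha\in\mathcal A$). For each generator $s\in\{s_{12},s_{23},s_{34},s_{45},s_{56},s_{123}\}$ and $\alpha\in\mathcal A$ put $s(y_\alpha)=y_\alpha$, $s(y_{-\alpha})=y_{-\alpha}$ if $s\alpha=\alpha$, and $s(y_\alpha)=y_{-\beta}$, $s(y_{-\alpha})=y_\beta$ if $s\alpha=\beta\neq\alpha$. The generator $s$ acts on points by sending $p$ to the point whose $y_{\pm\alpha}$-coordinate is the value of $s(y_{\pm\alpha})$ at $p$; these maps define (by composition) the action of $G$ on $\mathbb P^{80-1}$. For $g\in G$, $gy_{\pm\alpha}$ denotes the coordinate function (again one of the $80$ coordinates) obtained by composing $y_{\pm\alpha}$ with the coordinate permutation by which $g$ acts on points. **The map $\varphi$.** For a $3\times6$ matrix $x=(x_{ij})$ let $D_{ijk}(x)$ be the $3\times3$ minor on the columns $i,j,k$, always taken in increasing order (so $D_{ijk}$ does not depend on the order of the indices), and let $Q(x)$ here denote the determinant of the $6\times6$ matrix with columns $(x_{1j}x_{2j},\,x_{2j}x_{3j},\,x_{3j}x_{1j},\,x_{1j}^2,\,x_{2j}^2,\,x_{3j}^2)$, $j=1,\dots,6$. Define $$y_{(abc,def)}(x)=D_{abc}(x)D_{def}(x)Q(x),$$ $$y_{(ab,cd,ef)}(x)=D_{acd}(x)D_{bcd}(x)D_{cef}(x)D_{def}(x)D_{eab}(x)D_{fab}(x),$$ and $y_{-\alpha}(x)=-y_\alpha(x)$ for $\alpha\in\mathcal A$. Then $\varphi:M\to\mathbb P^{80-1}$ sends $x$ to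 the point with homogeneous coordinates $y_{\pm\alpha}(x)$, $\alpha\in\mathcal A$. In the displayed formula of the claim, $(gy_\alpha)(x)$ is the value at the matrix $x$ of the polynomial attached to the coordinate $gy_\alpha$. *)

theory Defs
  imports
    "HOL-Analysis.Analysis"
    "HOL-Algebra.Bij"
    "HOL-Algebra.Elementary_Groups"
begin

section \<open>The moduli space of marked cubic surfaces\<close>

text \<open>
  The index types 3, 4, 6 and 8 are the rings of integers modulo 3, 4, 6, 8, so that for instance
  the index 6 of the type 6 is written both as 6 and as 0.  All tuples and matrices below are
  indexed from 1, as in the function \<^const>\<open>vector\<close>.
\<close>

definition D1 :: "complex^4 \<Rightarrow> complex" where
  "D1 x = x$1 * x$4 - x$2 * x$3"

definition D2 :: "complex^4 \<Rightarrow> complex" where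
  "D2 x = x$1 * x$4 - x$4 + x$2 - x$2 * x$3 + x$3 - x$1"

definition Q4 :: "complex^4 \<Rightarrow> complex" where
  "Q4 x = - (x$1 * x$2 * x$3) - x$2 * x$3 * x$4 + x$2 * x$3
          + x$1 * x$2 * x$4 + x$1 * x$3 * x$4 - x$1 * x$4"

definition discr :: "complex^4 \<Rightarrow> complex" where
  "discr x = x$1 * x$2 * x$3 * x$4 * (x$1 - 1) * (x$2 - 1) * (x$3 - 1) * (x$4 - 1)
     * (x$1 - x$2) * (x$1 - x$3) * (x$2 - x$4) * (x$3 - x$4) * D1 x * D2 x * Q4 x"

definition M :: "(complex^4) set" where
  "M = {x. discr x \<noteq> 0}"

definition mat_of :: "complex^4 \<Rightarrow> complex^6^3" where
  "mat_of x = vector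
     [vector [1, 0, 0, 1, 1,   1],
      vector [0, 1, 0, 1, x$1, x$2],
      vector [0, 0, 1, 1, x$3, x$4]]"

definition s_map :: "nat \<Rightarrow> complex^4 \<Rightarrow> complex^4" where
  "s_map k x =
    (if k = 1 then vector [1 / x$1, 1 / x$2, x$3 / x$1, x$4 / x$2]
     else if k = 2 then vector [x$3, x$4, x$1, x$2]
     else if k = 3 then vector [(x$1 - x$3) / (1 - x$3), (x$2 - x$4) / (1 - x$4),
                                x$3 / (x$3 - 1), x$4 / (x$4 - 1)]
     else if k = 4 then vector [1 / x$1, x$2 / x$1, 1 / x$3, x$4 / x$3]
     else if k = 5 then vector [x$2, x$1, x$4, x$3]
     else vector [1 / x$1, 1 / x$2, 1 / x$3, 1 / x$4])"

definition s_bar :: "nat \<Rightarrow> complex^4 \<Rightarrow> complex^4" where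
  "s_bar k = restrict (s_map k) M"

text \<open>The group generated by the involutions of \<open>M\<close>; composition is the multiplication of \<^const>\<open>BijGroup\<close>.\<close>

definition G_bar :: "(complex^4 \<Rightarrow> complex^4) monoid" where
  "G_bar = subgroup_generated (BijGroup M) (s_bar ` {1..6})"


section \<open>The root system and its reflection group\<close>

definition eps :: "nat \<Rightarrow> real^8" where
  "eps i = axis (of_nat i) 1"

definition eps_tilde :: "real^8" where
  "eps_tilde = eps 6 - eps 7 - eps 8"

definition E :: "(real^8) set" where
  "E = span (eps ` {1..5} \<union> {eps_tilde})"

definition r_all :: "real^8" where
  "r_all = - ((1/2) *\<^sub>R ((\<Sum>i=1..5. eps i) + eps_tilde))"

definition r0 :: "real^8" where
  "r0 = (1/2) *\<^sub>R ((\<Sum>i=1..5. eps i) - eps_tilde)"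

text \<open>
  As the indices of \<open>r\<^sub>i\<^sub>j\<close> and \<open>r\<^sub>i\<^sub>j\<^sub>k\<close> may be permuted, these roots are indexed by the sets
  \<open>{i, j}\<close> and \<open>{i, j, k}\<close>.
\<close>

definition r2 :: "nat set \<Rightarrow> real^8" where
  "r2 S = (let j = Min S; k = Max S in
     if j = 1 then - eps (k - 1) + r0 else eps (j - 1) - eps (k - 1))"

definition r3 :: "nat set \<Rightarrow> real^8" where
  "r3 S = - (\<Sum>i\<in>S - {1}. eps (i - 1)) + (if 1 \<in> S then 0 else r0)"

definition gen_root :: "nat \<Rightarrow> real^8" where
  "gen_root k = (if k = 6 then r3 {1, 2, 3} else r2 {k, k + 1})"

definition reflection :: "real^8 \<Rightarrow> real^8 \<Rightarrow> real^8" where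
  "reflection a v = v - (2 * (v \<bullet> a) / (a \<bullet> a)) *\<^sub>R a"

text \<open>\<open>s_refl 1, \<dots>, s_refl 6\<close> are \<open>s\<^sub>1\<^sub>2, s\<^sub>2\<^sub>3, s\<^sub>3\<^sub>4, s\<^sub>4\<^sub>5, s\<^sub>5\<^sub>6, s\<^sub>1\<^sub>2\<^sub>3\<close>.\<close>

definition s_refl :: "nat \<Rightarrow> real^8 \<Rightarrow> real^8" where
  "s_refl k = restrict (reflection (gen_root k)) E"

definition G :: "(real^8 \<Rightarrow> real^8) monoid" where
  "G = subgroup_generated (BijGroup E) (s_refl ` {1..6})"


section \<open>Labels\<close>

text \<open>
  The identifications among the labels are built into the encoding: \<open>(abc,def)\<close> is the set of its
  two triples, and \<open>(ab,cd,ef)\<close> is the oriented 3-cycle \<open>ab \<rightarrow> cd \<rightarrow> ef \<rightarrow> ab\<close>, given as the set of its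
  arrows.
\<close>

datatype label =
    Tri "nat set set"
  | Cyc "(nat set \<times> nat set) set"

definition tri :: "nat \<Rightarrow> nat \<Rightarrow> nat \<Rightarrow> nat \<Rightarrow> nat \<Rightarrow> nat \<Rightarrow> label" where
  "tri a b c d e f = Tri {{a, b, c}, {d, e, f}}"

definition cyc :: "nat \<Rightarrow> nat \<Rightarrow> nat \<Rightarrow> nat \<Rightarrow> nat \<Rightarrow> nat \<Rightarrow> label" where
  "cyc a b c d e f = Cyc {({a, b}, {c, d}), ({c, d}, {e, f}), ({e, f}, {a, b})}"

definition labels :: "label set" where
  "labels = {tri a b c d e f | a b c d e f. {a, b, c, d, e, f} = {1..6}}
          \<union> {cyc a b c d e f | a b c d e f. {a, b, c, d, e, f} = {1..6}}"

definition pm :: "(real^8) set \<Rightarrow> (real^8) set" where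
  "pm V = V \<union> uminus ` V"

text \<open>
  The three mutually orthogonal \<open>A\<^sub>2\<close>-subsystems of a label.  The arrow \<open>ab \<rightarrow> cd\<close> contributes
  \<open>{\<plusminus>r\<^sub>a\<^sub>b, \<plusminus>r\<^sub>a\<^sub>c\<^sub>d, \<plusminus>r\<^sub>b\<^sub>c\<^sub>d}\<close>.
\<close>

fun A2_triple :: "label \<Rightarrow> (real^8) set set" where
  "A2_triple (Tri T) =
     {pm {r2 {i, j} | i j. i \<in> S \<and> j \<in> S \<and> i \<noteq> j} | S. S \<in> T} \<union> {pm ({r_all} \<union> r3 ` T)}"
| "A2_triple (Cyc C) =
     {pm ({r2 p} \<union> {r3 ({i} \<union> q) | i. i \<in> p}) | p q. (p, q) \<in> C}"

definition label_act :: "(real^8 \<Rightarrow> real^8) \<Rightarrow> label \<Rightarrow> label" where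
  "label_act g \<alpha> = (THE \<beta>. \<beta> \<in> labels \<and> A2_triple \<beta> = (image g) ` A2_triple \<alpha>)"


section \<open>The projective space and the action on it\<close>

text \<open>\<open>Pos \<alpha>\<close> and \<open>Neg \<alpha>\<close> stand for the homogeneous coordinates \<open>y\<^sub>\<alpha>\<close> and \<open>y\<^sub>-\<^sub>\<alpha>\<close>.\<close>

datatype coord = Pos label | Neg label

definition coords :: "coord set" where
  "coords = Pos ` labels \<union> Neg ` labels"

text \<open>The point of projective space with given homogeneous coordinates: its nonzero multiples.\<close>

definition proj_point :: "(coord \<Rightarrow> complex) \<Rightarrow> (coord \<Rightarrow> complex) set" where
  "proj_point v = {\<lambda>\<kappa>\<in>coords. c * v \<kappa> | c. c \<noteq> 0}"

definition P79 :: "(coord \<Rightarrow> complex) set set" where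
  "P79 = {proj_point v | v. \<exists>\<kappa>\<in>coords. v \<kappa> \<noteq> 0}"

fun gen_perm :: "nat \<Rightarrow> coord \<Rightarrow> coord" where
  "gen_perm k (Pos \<alpha>) =
     (let \<beta> = label_act (s_refl k) \<alpha> in if \<beta> = \<alpha> then Pos \<alpha> else Neg \<beta>)"
| "gen_perm k (Neg \<alpha>) =
     (let \<beta> = label_act (s_refl k) \<alpha> in if \<beta> = \<alpha> then Neg \<alpha> else Pos \<beta>)"

text \<open>
  A coordinate permutation \<open>\<pi>\<close> acts on points by \<open>p \<mapsto> p \<circ> \<pi>\<close>.  Hence if \<open>g\<close> acts through \<open>\<pi>\<close> and
  \<open>h\<close> through \<open>\<rho>\<close>, the product \<open>g h\<close> (first \<open>h\<close>, then \<open>g\<close>) acts through \<open>\<rho> \<circ> \<pi>\<close>.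
\<close>

definition point_act :: "(coord \<Rightarrow> coord) \<Rightarrow> (coord \<Rightarrow> complex) set \<Rightarrow> (coord \<Rightarrow> complex) set" where
  "point_act \<pi> p = (\<lambda>v. \<lambda>\<kappa>\<in>coords. v (\<pi> \<kappa>)) ` p"

text \<open>
  \<open>acts_by g \<pi>\<close>: the element \<open>g\<close> of \<open>G\<close> acts on points by the coordinate permutation \<open>\<pi>\<close>, so that
  \<open>g y\<^sub>\<kappa>\<close> is the coordinate \<open>\<pi> \<kappa>\<close>.  This is the action of the generators, extended by composition.
\<close>

inductive acts_by :: "(real^8 \<Rightarrow> real^8) \<Rightarrow> (coord \<Rightarrow> coord) \<Rightarrow> bool" where
  one: "acts_by \<one>\<^bsub>G\<^esub> id"
| gen: "acts_by g \<pi> \<Longrightarrow> k \<in> {1..6} \<Longrightarrow> acts_by (s_refl k \<otimes>\<^bsub>G\<^esub> g) (\<pi> \<circ> gen_perm k)"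


lemma s_refl_closed: "k \<in> {1..6} \<Longrightarrow> s_refl k \<in> carrier G"
proof -
  assume k: "k \<in> {1..6}"
  have e: "eps i \<in> E" if "i \<in> {1..5}" for i
    unfolding E_def using that by (intro span_base) auto
  have t: "eps_tilde \<in> E"
    unfolding E_def by (intro span_base) auto
  have sub: "subspace E"
    unfolding E_def by simp
  have r0: "r0 \<in> E"
    unfolding r0_def using e t by (intro subspace_scale subspace_diff subspace_sum sub) auto
  have "k = 1 \<or> k = 2 \<or> k = 3 \<or> k = 4 \<or> k = 5 \<or> k = 6"
    using k by auto
  then have root: "gen_root k \<in> E"
  proof (elim disjE)
    assume "k = 1" then show ?thesis
      using e[of 1] r0 by (auto simp: gen_root_def r2_def Let_def
        intro!: subspace_diff subspace_add subspace_neg sub)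
  next
    assume "k = 6" then show ?thesis
      using e[of 1] e[of 2] by (auto simp: gen_root_def r3_def insert_Diff_if
        intro!: subspace_diff subspace_add subspace_neg sub)
  qed (auto simp: gen_root_def r2_def Let_def intro!: subspace_diff sub e)
  have mem: "reflection (gen_root k) v \<in> E" if "v \<in> E" for v
    unfolding reflection_def using root that by (intro subspace_diff subspace_scale sub)
  have invol: "reflection a (reflection a v) = v" for a v
    by (cases "a = 0") (auto simp: reflection_def inner_diff_left algebra_simps
        simp flip: scaleR_add_left)
  have "bij_betw (s_refl k) E E"
    by (rule bij_betw_byWitness[where f' = "s_refl k"]) (auto simp: s_refl_def mem invol)
  then have "s_refl k \<in> carrier (BijGroup E)"
    by (auto simp: BijGroup_def Bij_def s_refl_def)
  then show ?thesis
    using k by (auto simp: G_def carrier_subgroup_generated intro!: generate.incl)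
qed

lemma s_refl_involution:
  assumes k: "k \<in> {1..6}"
  shows "s_refl k \<otimes>\<^bsub>G\<^esub> s_refl k = \<one>\<^bsub>G\<^esub>"
proof -
  have B: "s_refl k \<in> Bij E"
    using s_refl_closed[OF k] group.carrier_subgroup_generated_subset[OF group_BijGroup[of E]]
    by (auto simp: G_def BijGroup_def)
  have "reflection a (reflection a v) = v" for a v
    by (cases "a = 0") (auto simp: reflection_def inner_diff_left algebra_simps
        simp flip: scaleR_add_left)
  moreover have "s_refl k v \<in> E" if "v \<in> E" for v
    using B that by (auto simp: Bij_def bij_betw_def)
  ultimately have "compose E (s_refl k) (s_refl k) = (\<lambda>v\<in>E. v)"
    by (auto simp: compose_def s_refl_def fun_eq_iff)
  then show ?thesis
    using B by (simp add: G_def BijGroup_def subgroup_generated_def)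
qed

lemma acts_by_mult:
  assumes "acts_by g \<pi>" "acts_by h \<rho>"
  shows "acts_by (g \<otimes>\<^bsub>G\<^esub> h) (\<rho> \<circ> \<pi>)"
proof -
  interpret G: group G
    unfolding G_def by (simp add: group.group_subgroup_generated group_BijGroup)
  have closed: "g \<in> carrier G" if "acts_by g \<pi>" for g \<pi>
    using that by induction (auto simp: s_refl_closed)
  from assms(1) show ?thesis
  proof induction
    case one
    then show ?case using assms(2) closed by simp
  next
    case (gen g \<pi> k)
    then have "acts_by (s_refl k \<otimes>\<^bsub>G\<^esub> (g \<otimes>\<^bsub>G\<^esub> h)) ((\<rho> \<circ> \<pi>) \<circ> gen_perm k)"
      using acts_by.gen[of "g \<otimes>\<^bsub>G\<^esub> h" "\<rho> \<circ> \<pi>" k] by blast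
    then show ?case
      using gen closed assms(2) by (simp add: G.m_assoc s_refl_closed o_def)
  qed
qed

lemma acts_by_exists:
  assumes "g \<in> carrier G"
  shows "\<exists>\<pi>. acts_by g \<pi>"
proof -
  interpret B: group "BijGroup E" by (rule group_BijGroup)
  interpret G: group G
    unfolding G_def by (simp add: group.group_subgroup_generated group_BijGroup)
  have inB: "s_refl k \<in> carrier (BijGroup E)" if "k \<in> {1..6}" for k
    using s_refl_closed[OF that] B.carrier_subgroup_generated_subset by (auto simp: G_def)
  have s: "acts_by (s_refl k) (gen_perm k)" if "k \<in> {1..6}" for k
    using acts_by.gen[OF acts_by.one that] s_refl_closed[OF that] by simp
  have "g \<in> generate (BijGroup E) (carrier (BijGroup E) \<inter> s_refl ` {1..6})"
    using assms by (simp add: G_def carrier_subgroup_generated)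
  then show ?thesis
  proof induction
    case one
    then show ?case using acts_by.one by (auto simp: G_def)
  next
    case (incl h)
    then show ?case using s by blast
  next
    case (inv h)
    then obtain k where k: "k \<in> {1..6}" "h = s_refl k" by auto
    have "h \<otimes>\<^bsub>BijGroup E\<^esub> h = \<one>\<^bsub>BijGroup E\<^esub>"
      using s_refl_involution[OF k(1)] k(2) by (simp add: G_def)
    then have "inv\<^bsub>BijGroup E\<^esub> h = h"
      using inB k by (intro B.inv_equality) auto
    then show ?case using s[OF k(1)] k by auto
  next
    case (eng h1 h2)
    then obtain \<pi>1 \<pi>2 where "acts_by h1 \<pi>1" "acts_by h2 \<pi>2" by auto
    then have "acts_by (h1 \<otimes>\<^bsub>G\<^esub> h2) (\<pi>2 \<circ> \<pi>1)" by (rule acts_by_mult)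
    then show ?case by (auto simp: G_def)
  qed
qed


section \<open>The map to projective space\<close>

text \<open>The minor on the columns in \<open>S\<close> (three elements of \<open>{1..6}\<close>), taken in increasing order.\<close>

definition minor :: "nat set \<Rightarrow> complex^6^3 \<Rightarrow> complex" where
  "minor S X = det (transpose (vector
     (map (\<lambda>j. column (of_nat j) X) (sorted_list_of_set S))) :: complex^3^3)"

definition Q :: "complex^6^3 \<Rightarrow> complex" where
  "Q X = det ((\<chi> i j. vector
     [X$1$j * X$2$j, X$2$j * X$3$j, X$3$j * X$1$j, (X$1$j)^2, (X$2$j)^2, (X$3$j)^2] $ i)
     :: complex^6^6)"

text \<open>The arrow \<open>ab \<rightarrow> cd\<close> of \<open>(ab,cd,ef)\<close> contributes the factors \<open>D\<^sub>a\<^sub>c\<^sub>d D\<^sub>b\<^sub>c\<^sub>d\<close>.\<close>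

fun y_lab :: "label \<Rightarrow> complex^6^3 \<Rightarrow> complex" where
  "y_lab (Tri T) X = (\<Prod>S\<in>T. minor S X) * Q X"
| "y_lab (Cyc C) X = (\<Prod>(p, q)\<in>C. \<Prod>i\<in>p. minor ({i} \<union> q) X)"

fun y_poly :: "coord \<Rightarrow> complex^6^3 \<Rightarrow> complex" where
  "y_poly (Pos \<alpha>) X = y_lab \<alpha> X"
| "y_poly (Neg \<alpha>) X = - y_lab \<alpha> X"

definition \<phi> :: "complex^4 \<Rightarrow> (coord \<Rightarrow> complex) set" where
  "\<phi> x = proj_point (\<lambda>\<kappa>. y_poly \<kappa> (mat_of x))"


section \<open>Rational functions\<close>

text \<open>Complex polynomial functions; compare \<^const>\<open>real_polynomial_function\<close>.\<close>

inductive complex_polynomial_function :: "(complex^4 \<Rightarrow> complex) \<Rightarrow> bool" where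
  coordinate: "complex_polynomial_function (\<lambda>x. x $ i)"
| const: "complex_polynomial_function (\<lambda>x. c)"
| add: "complex_polynomial_function p \<Longrightarrow> complex_polynomial_function q
          \<Longrightarrow> complex_polynomial_function (\<lambda>x. p x + q x)"
| mult: "complex_polynomial_function p \<Longrightarrow> complex_polynomial_function q
          \<Longrightarrow> complex_polynomial_function (\<lambda>x. p x * q x)"

text \<open>A rational function in \<open>x\<^sub>1, \<dots>, x\<^sub>4\<close> without poles on \<open>M\<close>, seen as a function on \<open>M\<close>.\<close>

definition rational_function_on_M :: "(complex^4 \<Rightarrow> complex) \<Rightarrow> bool" where
  "rational_function_on_M c \<longleftrightarrow>
     (\<exists>p q. complex_polynomial_function p \<and> complex_polynomial_function q
        \<and> (\<forall>x\<in>M. q x \<noteq> 0 \<and> c x = p x / q x))"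

end

theory Submission
  imports Defs
begin

text \<open>
  The group \<open>G\<close> is generated by six reflections, so it suffices to find for each generator \<open>s\<close> one
  function \<open>c\<^sub>s\<close> that works for all labels; for a product of generators the factors multiply,
  each evaluated at the point already reached (\<open>acts_by_scales\<close>).

  For \<open>k \<le> 5\<close> the involution \<open>s_map k\<close> exchanges two neighbouring points of the six, up to a left
  multiplication by some \<open>A\<close> and scalings \<open>t\<^sub>i\<close> of the columns.  All polynomials \<open>y\<^sub>\<alpha>\<close> have the same
  degree 6 in \<open>det A\<close> and the same degree 3 in each column.  Therefore \<open>A\<close> and the \<open>t\<^sub>i\<close> produce one
  common factor, and the exchange itself only produces signs: \<open>D\<^sub>i\<^sub>j\<^sub>l\<close> changes sign when both exchanged
  columns are among \<open>i, j, l\<close>, since its columns are taken in increasing order, and \<open>Q\<close> always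
  changes sign.  Counting shows that the total sign is \<open>+\<close> if the label is fixed and \<open>-\<close> if it
  moves, which is exactly the rule by which the generators act on the 80 coordinates
  (\<open>transposition_step\<close>).

  The involution \<open>s_map 6\<close> is the standard Cremona transformation with base points 1, 2, 3.  It inverts
  the minors \<open>D\<^sub>a\<^sub>b\<^sub>j\<close> with \<open>a, b \<le> 3 < j\<close>, divides the minors \<open>D\<^sub>a\<^sub>j\<^sub>l\<close> with
  \<open>a \<le> 3 < j, l\<close>, up to sign, by a monomial in the \<open>D\<^sub>a\<^sub>b\<^sub>j\<close>, and interchanges \<open>D\<^sub>4\<^sub>5\<^sub>6\<close> and \<open>Q\<close> up to
  division by the product \<open>W\<close> of all \<open>D\<^sub>a\<^sub>b\<^sub>j\<close> (\<open>cremona_minors\<close>).  Up to permutations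
  of the base points and of the other points there are five kinds of labels, and for each of
  them the factor is \<open>W\<^sup>2\<close>, with the required sign (\<open>cremona_step\<close>).

  The action of a reflection on labels is defined through the root system.  In the description of
  the roots by divisor classes on the cubic surface, a root up to sign is the same as a subset of
  \<open>{1..6}\<close> with 2, 3 or 6 elements.  The reflections act on these subsets by transpositions of the
  indices and by the symmetric difference with \<open>{1, 2, 3}\<close>.  A label is determined by its set of
  such subsets, so that its images can be read off (\<open>label_act_eqI\<close>).
\<close>


section \<open>The minors and the conic condition\<close>

lemma vector_6:
  fixes a :: "'a::zero"
  shows "(vector [a, b, c, d, e, f] :: 'a^6) $ 1 = a"
    "(vector [a, b, c, d, e, f] :: 'a^6) $ 2 = b"
    "(vector [a, b, c, d, e, f] :: 'a^6) $ 3 = c"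
    "(vector [a, b, c, d, e, f] :: 'a^6) $ 4 = d"
    "(vector [a, b, c, d, e, f] :: 'a^6) $ 5 = e"
    "(vector [a, b, c, d, e, f] :: 'a^6) $ 0 = f"
  by (simp_all add: vector_def)

text \<open>
  The sixth column of a matrix with columns of type \<open>6\<close> has index \<open>0\<close>; this is how the numeral
  \<open>6\<close> produced by the embedding of \<open>nat\<close> is recognised.
\<close>
lemma six_eq_zero: "(6::6) = 0"
  by simp

lemma exhaust_6: "i = 1 \<or> i = 2 \<or> i = 3 \<or> i = 4 \<or> i = 5 \<or> i = 0" for i :: 6
proof (induct i)
  case (of_int z)
  then have "z = 0 \<or> z = 1 \<or> z = 2 \<or> z = 3 \<or> z = 4 \<or> z = 5"
    by fastforce
  then show ?case by auto
qed

lemma forall_6: "(\<forall>i::6. P i) \<longleftrightarrow> P 1 \<and> P 2 \<and> P 3 \<and> P 4 \<and> P 5 \<and> P 0"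
  by (metis exhaust_6)

lemma minor_eq:
  assumes "a < b" "b < c"
  shows "minor {a, b, c} X =
    (let u = of_nat a; v = of_nat b; w = of_nat c in
       X$1$u * (X$2$v * X$3$w - X$2$w * X$3$v)
     - X$1$v * (X$2$u * X$3$w - X$2$w * X$3$u)
     + X$1$w * (X$2$u * X$3$v - X$2$v * X$3$u))"
proof -
  have "sorted_list_of_set (set [a, b, c]) = [a, b, c]"
    using assms by (intro sorted_list_of_set.idem_if_sorted_distinct) auto
  then have "sorted_list_of_set {a, b, c} = [a, b, c]"
    by (simp only: list.set)
  then show ?thesis
    unfolding minor_def by (simp add: det_3 column_def Let_def Finite_Cartesian_Product.transpose_def del: sorted_list_of_set_insert)
      (simp add: algebra_simps)
qed

lemma mat_of_entries:
  "mat_of x $ 1 $ 1 = 1" "mat_of x $ 1 $ 2 = 0" "mat_of x $ 1 $ 3 = 0"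
  "mat_of x $ 1 $ 4 = 1" "mat_of x $ 1 $ 5 = 1" "mat_of x $ 1 $ 0 = 1"
  "mat_of x $ 2 $ 1 = 0" "mat_of x $ 2 $ 2 = 1" "mat_of x $ 2 $ 3 = 0"
  "mat_of x $ 2 $ 4 = 1" "mat_of x $ 2 $ 5 = x$1" "mat_of x $ 2 $ 0 = x$2"
  "mat_of x $ 3 $ 1 = 0" "mat_of x $ 3 $ 2 = 0" "mat_of x $ 3 $ 3 = 1"
  "mat_of x $ 3 $ 4 = 1" "mat_of x $ 3 $ 5 = x$3" "mat_of x $ 3 $ 0 = x$4"
  by (simp_all add: mat_of_def vector_6)

lemma minors_mat_of:
  "minor {1,2,3} (mat_of x) = 1"
  "minor {1,2,4} (mat_of x) = 1"
  "minor {1,2,5} (mat_of x) = x$3"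
  "minor {1,2,6} (mat_of x) = x$4"
  "minor {1,3,4} (mat_of x) = -1"
  "minor {1,3,5} (mat_of x) = - x$1"
  "minor {1,3,6} (mat_of x) = - x$2"
  "minor {1,4,5} (mat_of x) = x$3 - x$1"
  "minor {1,4,6} (mat_of x) = x$4 - x$2"
  "minor {1,5,6} (mat_of x) = D1 x"
  "minor {2,3,4} (mat_of x) = 1"
  "minor {2,3,5} (mat_of x) = 1"
  "minor {2,3,6} (mat_of x) = 1"
  "minor {2,4,5} (mat_of x) = 1 - x$3"
  "minor {2,4,6} (mat_of x) = 1 - x$4"
  "minor {2,5,6} (mat_of x) = x$3 - x$4"
  "minor {3,4,5} (mat_of x) = x$1 - 1"
  "minor {3,4,6} (mat_of x) = x$2 - 1"
  "minor {3,5,6} (mat_of x) = x$2 - x$1"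
  "minor {4,5,6} (mat_of x) = D2 x"
  by (simp_all add: minor_eq mat_of_entries D1_def D2_def algebra_simps six_eq_zero)

text \<open>
  Rows that are unit vectors on the diagonal force a permutation with nonzero contribution to fix
  their indices, so the Leibniz sum shrinks to the remaining rows.
\<close>
lemma det_unit_rows:
  fixes A :: "'a::comm_ring_1^'n^'n"
  assumes "\<And>i j. i \<notin> S \<Longrightarrow> A $ i $ j = (if i = j then 1 else 0)"
  shows "det A = (\<Sum>p | p permutes S. of_int (sign p) * (\<Prod>i\<in>S. A $ i $ p i))"
proof -
  have "det A = (\<Sum>p | p permutes S. of_int (sign p) * (\<Prod>i\<in>UNIV. A $ i $ p i))"
    unfolding det_def
  proof (rule sum.mono_neutral_right)
    show "finite {p. p permutes (UNIV :: 'n set)}"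
      by (rule finite_permutations) simp
    show "{p. p permutes S} \<subseteq> {p. p permutes UNIV}"
      using permutes_subset by blast
    show "\<forall>p\<in>{p. p permutes UNIV} - {p. p permutes S}. of_int (sign p) * (\<Prod>i\<in>UNIV. A $ i $ p i) = 0"
    proof
      fix p assume "p \<in> {p. p permutes (UNIV :: 'n set)} - {p. p permutes S}"
      then obtain i where "i \<notin> S" "p i \<noteq> i"
        by (auto simp: permutes_def)
      then have "A $ i $ p i = 0"
        using assms by simp
      then have "(\<Prod>i\<in>UNIV. A $ i $ p i) = 0"
        by (intro prod_zero) auto
      then show "of_int (sign p) * (\<Prod>i\<in>UNIV. A $ i $ p i) = 0"
        by simp
    qed
  qed
  also have "\<dots> = (\<Sum>p | p permutes S. of_int (sign p) * (\<Prod>i\<in>S. A $ i $ p i))"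
  proof (rule sum.cong[OF refl])
    fix p assume "p \<in> {p. p permutes S}"
    then have "\<forall>i\<in>UNIV - S. A $ i $ p i = 1"
      using assms by (auto simp: permutes_def)
    then have "(\<Prod>i\<in>UNIV. A $ i $ p i) = (\<Prod>i\<in>S. A $ i $ p i)"
      by (intro prod.mono_neutral_right) auto
    then show "of_int (sign p) * (\<Prod>i\<in>UNIV. A $ i $ p i) = of_int (sign p) * (\<Prod>i\<in>S. A $ i $ p i)"
      by simp
  qed
  finally show ?thesis .
qed

text \<open>
  The first three points of \<open>mat_of x\<close> are the coordinate points, and the quadratic monomials at a
  coordinate point form a unit vector.  Hence the \<open>6 \<times> 6\<close> determinant reduces to the \<open>3 \<times> 3\<close>
  determinant of the mixed monomials at the last three points.  The minus sign is the sign of the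
  three transpositions that move the unit vectors onto the diagonal.
\<close>
lemma Q_mat_of: "Q (mat_of x) = - Q4 x"
proof -
  let ?X = "mat_of x"
  let ?v = "\<lambda>j. vector [?X$1$j * ?X$2$j, ?X$2$j * ?X$3$j, ?X$3$j * ?X$1$j,
    (?X$1$j)^2, (?X$2$j)^2, (?X$3$j)^2] :: complex^6"
  \<comment> \<open>The monomials \<open>x\<^sub>1\<^sup>2, x\<^sub>2\<^sup>2, x\<^sub>3\<^sup>2\<close> are the entries 4, 5, 0, and they are read off at the columns 1, 2, 3.\<close>
  let ?\<pi> = "Transposition.transpose 1 4 \<circ> (Transposition.transpose 2 5 \<circ> Transposition.transpose 3 0) :: 6 \<Rightarrow> 6"
  define A :: "complex^6^6" where "A = (\<chi> j. ?v (?\<pi> j))"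
  have "Q ?X = det (\<chi> j. ?v j)"
    unfolding Q_def by (subst det_transpose[symmetric]) (simp add: Finite_Cartesian_Product.transpose_def vec_lambda_eta)
  moreover have "det A = of_int (sign ?\<pi>) * det (\<chi> j. ?v j)"
    using det_permute_rows[of ?\<pi> "\<chi> j. ?v j"]
    by (simp add: A_def permutes_compose permutes_swap_id)
  moreover have "sign ?\<pi> = -1"
    by (simp add: sign_compose sign_swap_id permutation_swap_id permutation_compose)
  moreover have "det A = (\<Sum>p | p permutes {1, 2, 3}. of_int (sign p) * (\<Prod>i\<in>{1, 2, 3}. A $ i $ p i))"
  proof (rule det_unit_rows)
    fix i j :: 6
    assume "i \<notin> {1, 2, 3}"
    moreover have "\<forall>i. i \<notin> {1, 2, 3} \<longrightarrow> (\<forall>j. A $ i $ j = (if i = j then 1 else 0))"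
      by (simp add: forall_6 A_def Transposition.transpose_def vector_6 mat_of_entries)
    ultimately show "A $ i $ j = (if i = j then 1 else 0)"
      by blast
  qed
  moreover have "\<dots> = Q4 x"
  proof -
    have f: "finite {2::6, 3}" "1 \<notin> {2::6, 3}" "finite {3::6}" "2 \<notin> {3::6}"
      by auto
    have "A $ 1 = ?v 4" "A $ 2 = ?v 5" "A $ 3 = ?v 0"
      by (simp_all add: A_def Transposition.transpose_def)
    then show ?thesis
      unfolding sum_over_permutations_insert[OF f(1,2)] sum_over_permutations_insert[OF f(3,4)]
        permutes_sing
      by (simp add: sign_swap_id permutation_swap_id sign_compose sign_id swap_id_eq
          vector_6 mat_of_entries Q4_def algebra_simps)
  qed
  ultimately have "- Q ?X = Q4 x"
    by simp
  then show ?thesis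
    by (metis minus_minus)
qed


section \<open>The involutions of the moduli space on minors\<close>

definition adj_swap :: "nat \<Rightarrow> nat \<Rightarrow> nat" where
  "adj_swap k = Transposition.transpose k (k + 1)"

lemma adj_swap_apply: "adj_swap k i = (if i = k then k + 1 else if i = k + 1 then k else i)"
  by (simp add: adj_swap_def Transposition.transpose_def)

lemma vector_4:
  fixes a :: "'a::zero"
  shows "(vector [a, b, c, d] :: 'a^4) $ 1 = a"
    "(vector [a, b, c, d] :: 'a^4) $ 2 = b"
    "(vector [a, b, c, d] :: 'a^4) $ 3 = c"
    "(vector [a, b, c, d] :: 'a^4) $ 4 = d"
  by (simp_all add: vector_def)

text \<open>
  For \<open>k \<le> 5\<close> the involution \<open>s_map k\<close> exchanges the points \<open>k\<close> and \<open>k + 1\<close> and brings the matrix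
  back to normal form: column \<open>i\<close> of \<open>mat_of (s_map k x)\<close> is \<open>t\<^sub>i\<close> times \<open>A\<close> times column
  \<open>adj_swap k i\<close> of \<open>mat_of x\<close>, for an invertible \<open>3 \<times> 3\<close> matrix \<open>A\<close>.  Here \<open>t\<^sub>i\<close> is
  \<open>column_scale k x i\<close> and \<open>det A\<close> is \<open>row_det k x\<close>.
\<close>
definition column_scale :: "nat \<Rightarrow> complex^4 \<Rightarrow> nat \<Rightarrow> complex" where
  "column_scale k x i =
    (if k = 1 then (if i = 5 then 1 / x$1 else if i = 6 then 1 / x$2 else 1)
     else if k = 3 then (if i = 3 \<or> i = 4 then -1 else if i = 5 then 1 / (1 - x$3)
        else if i = 6 then 1 / (1 - x$4) else 1)
     else if k = 4 then (if i = 2 then x$1 else if i = 3 then x$3 else 1)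
     else 1)"

definition row_det :: "nat \<Rightarrow> complex^4 \<Rightarrow> complex" where
  "row_det k x = (if k = 4 then 1 / (x$1 * x$3) else if k = 5 then 1 else -1)"

lemma M_nonzero:
  assumes "x \<in> M"
  shows "x$1 \<noteq> 0" "x$2 \<noteq> 0" "x$3 \<noteq> 0" "x$4 \<noteq> 0" "x$3 \<noteq> 1" "x$4 \<noteq> 1"
    "D1 x \<noteq> 0" "D2 x \<noteq> 0" "Q4 x \<noteq> 0"
  using assms by (auto simp: M_def discr_def)

lemma one_to_six: "{1..6::nat} = {1,2,3,4,5,6}"
  by auto

lemma less_triple_cases:
  assumes "S \<subseteq> {1..6::nat}" "card S = 3"
  obtains a b c where "S = {a, b, c}" "a < b" "b < c"
proof -
  obtain a b c where *: "S = {a, b, c}" "a \<noteq> b" "b \<noteq> c" "a \<noteq> c"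
    using assms(2) by (auto simp: card_3_iff)
  then show thesis
    using that by (metis insert_commute linorder_neqE_nat)
qed

lemma triple_cases:
  assumes "S \<subseteq> {1..6::nat}" "card S = 3"
  shows "S \<in> {{1,2,3},{1,2,4},{1,2,5},{1,2,6},{1,3,4},{1,3,5},{1,3,6},{1,4,5},{1,4,6},{1,5,6},
    {2,3,4},{2,3,5},{2,3,6},{2,4,5},{2,4,6},{2,5,6},{3,4,5},{3,4,6},{3,5,6},{4,5,6}}"
proof -
  obtain a b c where S: "S = {a, b, c}" "a < b" "b < c"
    using less_triple_cases[OF assms] .
  then have "a \<in> {1..4}" "b \<in> {2..5}" "c \<in> {3..6}" using assms(1) by auto
  then have "a \<in> {1,2,3,4}" "b \<in> {2,3,4,5}" "c \<in> {3,4,5,6}" by (auto)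
  with S(2,3) show ?thesis unfolding S(1) by (elim insertE emptyE) simp_all
qed

text \<open>
  Minors are multiplicative under \<open>A\<close> and under column scalings.  The sign is there because minors are
  taken with increasing columns: exchanging \<open>k\<close> and \<open>k + 1\<close> disturbs the order of the columns
  exactly when both of them occur.
\<close>
lemma minor_s_map:
  assumes x: "x \<in> M" and k: "k \<in> {1..5}" and S: "S \<subseteq> {1..6}" "card S = 3"
  shows "minor S (mat_of (s_map k x)) =
    (if {k, k + 1} \<subseteq> S then -1 else 1) * row_det k x * (\<Prod>i\<in>S. column_scale k x i)
     * minor (adj_swap k ` S) (mat_of x)"
proof -
  note nz = M_nonzero[OF x]
  have sort: "{2, 1, a} = {1, 2, a}" "{3, 2, a} = {2, 3, a}" "{4, 3, a} = {3, 4, a}" "{5, 4, a} = {4, 5, a}"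
     "{b, 3, 2} = {b, 2, 3}" "{b, 4, 3} = {b, 3, 4}" "{b, 5, 4} = {b, 4, 5}" "{b, 6, 5} = {b, 5, 6}" for a b :: nat
    by auto
  have "k = 1 \<or> k = 2 \<or> k = 3 \<or> k = 4 \<or> k = 5"
    using k by auto
  then show ?thesis
    using triple_cases[OF S]
    apply (elim insertE emptyE disjE; hypsubst; unfold image_insert image_empty)
    apply (simp_all add: adj_swap_apply minors_mat_of s_map_def row_det_def column_scale_def nz sort
      D1_def D2_def divide_simps vector_4 del: One_nat_def)
    apply (simp_all add: algebra_simps nz)?
    done
qed

text \<open>
  \<open>A\<close> acts on quadratic monomials by its symmetric square, whose determinant is \<open>(det A)\<^sup>4\<close>, each
  column of the \<open>6 \<times> 6\<close> matrix is quadratic in the column scaling, and exchanging two columns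
  changes the sign.
\<close>
lemma Q_s_map:
  assumes x: "x \<in> M" and k: "k \<in> {1..5}"
  shows "Q (mat_of (s_map k x)) =
    - (row_det k x ^ 4 * (\<Prod>i\<in>{1..6}. column_scale k x i)\<^sup>2 * Q (mat_of x))"
proof -
  have "k = 1 \<or> k = 2 \<or> k = 3 \<or> k = 4 \<or> k = 5"
    using k by auto
  then show ?thesis
    unfolding Q_mat_of one_to_six using M_nonzero[OF x]
    apply (elim disjE; hypsubst)
    apply (simp_all add: s_map_def row_det_def column_scale_def vector_4 Q4_def divide_simps del: One_nat_def)
    apply (simp_all add: power2_eq_square power4_eq_xxxx)?
    apply (simp_all add: algebra_simps)?
    done
qed

text \<open>
  The involution \<open>s_map 6\<close> is the standard Cremona transformation with base points 1, 2, 3, which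
  inverts coordinates.  Its weight is the product of the nine minors \<open>D\<^sub>a\<^sub>b\<^sub>j\<close> with \<open>a, b \<in> {1, 2, 3}\<close> and
  \<open>j \<in> {4, 5, 6}\<close>, which up to sign are the coordinates of the points 4, 5, 6.
\<close>
definition cremona_weight :: "complex^4 \<Rightarrow> complex" where
  "cremona_weight x = - (x$1 * x$2 * x$3 * x$4)"

lemma perm3_cases:
  assumes "{a, b, c} = {u, v, w}" "u \<noteq> v" "v \<noteq> w" "u \<noteq> w"
  shows "(a, b, c) \<in> {(u,v,w),(u,w,v),(v,u,w),(v,w,u),(w,u,v),(w,v,u)}"
proof -
  have "card (set [a, b, c]) = length [a, b, c]"
    using assms by simp
  then have "distinct [a, b, c]"
    by (rule card_distinct)
  moreover have "a \<in> {u, v, w}" "b \<in> {u, v, w}" "c \<in> {u, v, w}"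
    using assms(1) by blast+
  ultimately show ?thesis
    by auto
qed

text \<open>
  The minors \<open>D\<^sub>a\<^sub>b\<^sub>d\<close> are coordinates up to sign, so they are inverted.  Inverting the coordinates in the
  \<open>2 \<times> 2\<close> determinant that is \<open>D\<^sub>a\<^sub>d\<^sub>e\<close> up to sign reproduces it with a minus sign and a denominator.  The mixed monomials
  \<open>x\<^sub>1x\<^sub>2, x\<^sub>2x\<^sub>3, x\<^sub>3x\<^sub>1\<close> of a point are its inverted coordinates times \<open>x\<^sub>1x\<^sub>2x\<^sub>3\<close>, which is why \<open>D\<^sub>4\<^sub>5\<^sub>6\<close> and
  \<open>Q\<close> are interchanged.
\<close>
lemma cremona_minors:
  assumes x: "x \<in> M" and abc: "{a, b, c} = {1, 2, 3}" and def: "{d, e, f} = {4, 5, 6}"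
  defines "m \<equiv> \<lambda>S. minor S (mat_of x)" and "m' \<equiv> \<lambda>S. minor S (mat_of (s_map 6 x))"
  shows "m' {a, b, d} = 1 / m {a, b, d}"
    "m' {a, d, e} = - m {a, d, e} / (m {a, b, d} * m {a, b, e} * m {a, c, d} * m {a, c, e})"
    "m' {a, b, c} = 1" "m {a, b, c} = 1"
    "m' {d, e, f} = Q (mat_of x) / cremona_weight x"
    "Q (mat_of (s_map 6 x)) = m {d, e, f} / cremona_weight x"
    "cremona_weight x = m {a, b, d} * m {a, b, e} * m {a, b, f} * m {a, c, d} * m {a, c, e} * m {a, c, f}
      * m {b, c, d} * m {b, c, e} * m {b, c, f}"
    "m {a, b, d} \<noteq> 0"
proof -
  have sort: "{2, 1, b} = {1, 2, b}" "{3, 1, b} = {1, 3, b}" "{3, 2, b} = {2, 3, b}"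
    "{b, 5, 4} = {b, 4, 5}" "{b, 6, 4} = {b, 4, 6}" "{b, 6, 5} = {b, 5, 6}" for b :: nat
    by auto
  have *: "(a, b, c) \<in> {(1,2,3),(1,3,2),(2,1,3),(2,3,1),(3,1,2),(3,2,1)}"
    by (rule perm3_cases[OF abc]) simp_all
  have **: "(d, e, f) \<in> {(4,5,6),(4,6,5),(5,4,6),(5,6,4),(6,4,5),(6,5,4)}"
    by (rule perm3_cases[OF def]) simp_all
  note nz = M_nonzero[OF x]
  show "m' {a, b, d} = 1 / m {a, b, d}"
    using * ** unfolding m_def m'_def
    by (elim insertE emptyE; clarify; simp only: sort minors_mat_of s_map_def; simp add: nz vector_4)
  show "m' {a, d, e} = - m {a, d, e} / (m {a, b, d} * m {a, b, e} * m {a, c, d} * m {a, c, e})"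
    using * ** unfolding m_def m'_def
    by (elim insertE emptyE; clarify; simp only: sort minors_mat_of s_map_def; simp add: nz vector_4 D1_def divide_simps; simp add: algebra_simps)
  show "m' {a, b, c} = 1" "m {a, b, c} = 1"
    unfolding abc m_def m'_def by (simp_all only: minors_mat_of)
  show "m' {d, e, f} = Q (mat_of x) / cremona_weight x"
    "Q (mat_of (s_map 6 x)) = m {d, e, f} / cremona_weight x"
    using nz unfolding m_def m'_def def Q_mat_of minors_mat_of
    apply (simp_all add: s_map_def vector_4 cremona_weight_def D2_def Q4_def divide_simps)
    apply (simp_all add: algebra_simps)
    done
  show "cremona_weight x = m {a, b, d} * m {a, b, e} * m {a, b, f} * m {a, c, d} * m {a, c, e} * m {a, c, f}
      * m {b, c, d} * m {b, c, e} * m {b, c, f}" "m {a, b, d} \<noteq> 0"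
    using * ** unfolding m_def cremona_weight_def
    by (elim insertE emptyE; clarify; simp only: sort minors_mat_of; simp add: nz vector_4 D1_def algebra_simps)+
qed


section \<open>The coordinate functions of the labels\<close>

lemma distinct_if_six:
  assumes "{a, b, c, d, e, f} = {1..6::nat}"
  shows "distinct [a, b, c, d, e, f]"
proof -
  have "card (set [a, b, c, d, e, f]) = length [a, b, c, d, e, f]"
    using assms by simp
  then show ?thesis
    by (rule card_distinct)
qed

lemma y_lab_tri:
  assumes "{a, b, c, d, e, f} = {1..6}"
  shows "y_lab (tri a b c d e f) X = minor {a, b, c} X * minor {d, e, f} X * Q X"
proof -
  have "a \<notin> {d, e, f}"
    using distinct_if_six[OF assms] by auto
  then have "{a, b, c} \<noteq> {d, e, f}"
    by blast
  then show ?thesis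
    by (simp add: tri_def)
qed

lemma y_lab_cyc:
  assumes "{a, b, c, d, e, f} = {1..6}"
  shows "y_lab (cyc a b c d e f) X = minor {a, c, d} X * minor {b, c, d} X * minor {c, e, f} X
    * minor {d, e, f} X * minor {e, a, b} X * minor {f, a, b} X"
proof -
  have d: "distinct [a, b, c, d, e, f]"
    using distinct_if_six[OF assms] .
  then have "{a, b} \<noteq> {c, d}" "{a, b} \<noteq> {e, f}" "{c, d} \<noteq> {e, f}"
    by (auto simp: doubleton_eq_iff)
  then show ?thesis
    using d by (simp add: cyc_def mult.assoc)
qed


section \<open>The roots as divisor classes\<close>

lemma eps_inner:
  assumes "i \<in> {1..8}" "j \<in> {1..8}"
  shows "eps i \<bullet> eps j = (if i = j then 1 else 0)"
proof -
  have "i \<in> {1,2,3,4,5,6,7,8}" "j \<in> {1,2,3,4,5,6,7,8}"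
    using assms by auto
  then show ?thesis
    unfolding eps_def inner_axis_axis by (elim insertE emptyE) simp_all
qed

text \<open>
  A cubic surface is the plane blown up in six points, and \<open>E\<close> is the orthogonal complement of the
  canonical class in its real Picard space, with the negated intersection form.  The vectors \<open>line_class\<close>
  and \<open>exc_class i\<close> are the projections to \<open>E\<close> of the class of a line and of the exceptional classes.  In terms of them the
  roots have a description that is symmetric in the six indices.
\<close>
definition exc_class :: "nat \<Rightarrow> real^8" where
  "exc_class i = (if i = 1 then r0 else eps (i - 1)) + (1/3) *\<^sub>R eps_tilde"

definition line_class :: "real^8" where
  "line_class = r0 + eps_tilde"

lemma eps_tilde_inner:
  "eps_tilde \<bullet> eps_tilde = 3"
  "i \<in> {1..5} \<Longrightarrow> eps i \<bullet> eps_tilde = 0"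
  by (simp_all add: eps_tilde_def inner_diff_left inner_diff_right eps_inner)

lemma r0_inner:
  "r0 \<bullet> r0 = 2" "r0 \<bullet> eps_tilde = - 3 / 2"
  "i \<in> {1..5} \<Longrightarrow> eps i \<bullet> r0 = 1 / 2"
proof -
  have e: "eps i \<bullet> (\<Sum>j=1..5. eps j) = 1" if "i \<in> {1..5}" for i
  proof -
    have "eps i \<bullet> (\<Sum>j=1..5. eps j) = (\<Sum>j=1..5. if i = j then 1 else 0)"
      unfolding inner_sum_right using that by (intro sum.cong) (auto simp: eps_inner)
    then show ?thesis using that by simp
  qed
  have t: "(\<Sum>j=1..5. eps j) \<bullet> eps_tilde = 0"
    unfolding inner_sum_left by (intro sum.neutral) (simp add: eps_tilde_inner)
  have s: "(\<Sum>j=1..5. eps j) \<bullet> (\<Sum>j=1..5. eps j) = 5"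
    unfolding inner_sum_left by (simp add: e del: One_nat_def)
  show "r0 \<bullet> r0 = 2" "r0 \<bullet> eps_tilde = - 3 / 2"
    using s t by (simp_all add: r0_def inner_diff_left inner_diff_right inner_commute eps_tilde_inner)
  show "eps i \<bullet> r0 = 1 / 2" if "i \<in> {1..5}"
    using that e[OF that] eps_tilde_inner(2)[OF that] by (simp add: r0_def inner_diff_right)
qed

lemma exc_class_inner:
  assumes "i \<in> {1..6}" "j \<in> {1..6}"
  shows "exc_class i \<bullet> exc_class j = (if i = j then 4/3 else 1/3)"
proof -
  have *: "i = 1 \<and> j = 1 \<or> i = 1 \<and> j - 1 \<in> {1..5} \<and> i \<noteq> j \<or> i - 1 \<in> {1..5} \<and> j = 1 \<and> i \<noteq> j
    \<or> i - 1 \<in> {1..5} \<and> j - 1 \<in> {1..5} \<and> i \<noteq> 1 \<and> j \<noteq> 1 \<and> (i - 1 = j - 1 \<longleftrightarrow> i = j)"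
    using assms by (cases "i = 1"; cases "j = 1") auto
  have eps_tilde_inner': "x \<in> {1..5} \<Longrightarrow> eps_tilde \<bullet> eps x = 0" for x
    by (simp add: inner_commute[of eps_tilde] eps_tilde_inner)
  have r0_inner': "eps_tilde \<bullet> r0 = - 3 / 2" "x \<in> {1..5} \<Longrightarrow> r0 \<bullet> eps x = 1 / 2" for x
    by (simp_all add: inner_commute[of eps_tilde r0] inner_commute[of r0 "eps x"] r0_inner)
  from * show ?thesis
    by (elim disjE conjE) (simp_all add: exc_class_def inner_add_left inner_add_right eps_tilde_inner
      r0_inner eps_inner eps_tilde_inner' r0_inner' del: One_nat_def)
qed

lemma line_class_inner:
  "line_class \<bullet> line_class = 2" "i \<in> {1..6} \<Longrightarrow> line_class \<bullet> exc_class i = 1"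
proof -
  show "line_class \<bullet> line_class = 2"
    by (simp add: line_class_def inner_add_left inner_add_right eps_tilde_inner r0_inner inner_commute[of eps_tilde r0])
  assume "i \<in> {1..6}"
  then have "i = 1 \<or> i - 1 \<in> {1..5}"
    by auto
  then show "line_class \<bullet> exc_class i = 1"
    using eps_tilde_inner(2)[of "i - 1"] r0_inner(3)[of "i - 1"]
    by (auto simp: line_class_def exc_class_def inner_add_left inner_add_right eps_tilde_inner(1) r0_inner(1,2)
      inner_commute[of _ "eps _"] inner_commute[of eps_tilde r0])
qed

lemma eps_in_E: "i \<in> {1..5} \<Longrightarrow> eps i \<in> E"
  unfolding E_def by (intro span_base) auto

lemma eps_tilde_in_E: "eps_tilde \<in> E"
  unfolding E_def by (intro span_base) auto

lemma subspace_E: "subspace E"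
  unfolding E_def by simp

lemma r0_in_E: "r0 \<in> E"
  unfolding r0_def
  by (intro subspace_scale subspace_diff subspace_sum subspace_E eps_in_E eps_tilde_in_E)

lemma exc_class_in_E: "i \<in> {1..6} \<Longrightarrow> exc_class i \<in> E"
  unfolding exc_class_def
  by (auto intro!: subspace_add subspace_scale subspace_E r0_in_E eps_in_E eps_tilde_in_E)

lemma line_class_in_E: "line_class \<in> E"
  unfolding line_class_def by (intro subspace_add subspace_E r0_in_E eps_tilde_in_E)

lemma r2_eq:
  assumes "1 \<le> i" "i < j"
  shows "r2 {i, j} = exc_class i - exc_class j"
  using assms by (auto simp: r2_def exc_class_def Let_def)

lemma r3_eq:
  assumes "S \<subseteq> {1..6}" "card S = 3"
  shows "r3 S = line_class - (\<Sum>i\<in>S. exc_class i)"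
proof -
  have fin: "finite S"
    using assms(1) finite_subset by blast
  have "(\<Sum>i\<in>S. exc_class i) = (\<Sum>i\<in>S. if i = 1 then r0 else eps (i - 1)) + eps_tilde"
    by (simp add: exc_class_def sum.distrib assms(2) sum_constant_scaleR del: One_nat_def)
  also have "(\<Sum>i\<in>S. if i = 1 then r0 else eps (i - 1)) =
      (if 1 \<in> S then r0 else 0) + (\<Sum>i\<in>S - {1}. eps (i - 1))"
    using fin by (simp add: sum.remove[of S 1] del: One_nat_def) (auto intro!: sum.cong)
  finally show ?thesis
    by (auto simp: r3_def line_class_def)
qed

lemma r_all_eq: "r_all = 2 *\<^sub>R line_class - (\<Sum>i=1..6. exc_class i)"
proof -
  have "(\<Sum>i=1..6. exc_class i) = exc_class 1 + (\<Sum>i=1..5. exc_class (i + 1))"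
    by (simp add: eval_nat_numeral)
  also have "(\<Sum>i=1..5. exc_class (i + 1)) = (\<Sum>i=1..5. eps i) + (5/3) *\<^sub>R eps_tilde"
    by (simp add: exc_class_def sum.distrib sum_constant_scaleR)
  finally have "(\<Sum>i=1..6. exc_class i) = r0 + (\<Sum>i=1..5. eps i) + 2 *\<^sub>R eps_tilde"
    by (simp add: exc_class_def flip: scaleR_add_left)
  moreover have "(\<Sum>i=1..5. eps i) = 2 *\<^sub>R r0 + eps_tilde"
    by (simp add: r0_def scaleR_diff_right)
  ultimately show ?thesis
    by (simp add: r_all_def line_class_def scaleR_add_right)
qed

text \<open>
  Up to sign a root is determined by the set of those indices \<open>i\<close> for which it is not orthogonal to
  \<open>exc_class i\<close>.  This set is \<open>{i, j}\<close> for \<open>r\<^sub>i\<^sub>j\<close>, \<open>{i, j, k}\<close> for \<open>r\<^sub>i\<^sub>j\<^sub>k\<close> and \<open>{1..6}\<close> for \<open>r\<close>.  Thus pairs of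
  opposite roots correspond to the subsets of \<open>{1..6}\<close> with 2, 3 or 6 elements.
\<close>
definition root_of :: "nat set \<Rightarrow> real^8" where
  "root_of S = (if card S = 2 then r2 S else if card S = 3 then r3 S else r_all)"

definition root_supports :: "nat set set" where
  "root_supports = {S. S \<subseteq> {1..6} \<and> card S \<in> {2, 3, 6}}"

definition support :: "real^8 \<Rightarrow> nat set" where
  "support v = {i \<in> {1..6}. v \<bullet> exc_class i \<noteq> 0}"

lemma root_supports_cases:
  assumes "S \<in> root_supports"
  obtains i j where "S = {i, j}" "1 \<le> i" "i < j" "j \<le> 6" "root_of S = exc_class i - exc_class j"
  | "S \<subseteq> {1..6}" "card S = 3" "root_of S = line_class - (\<Sum>i\<in>S. exc_class i)"
  | "S = {1..6}" "root_of S = 2 *\<^sub>R line_class - (\<Sum>i=1..6. exc_class i)"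
proof -
  consider "card S = 2" | "card S = 3" | "card S = 6"
    using assms by (auto simp: root_supports_def)
  then show thesis
  proof cases
    case 1
    then obtain i j where "S = {i, j}" "i \<noteq> j"
      by (auto simp: card_2_iff)
    then obtain i j where "S = {i, j}" "i < j"
      by (metis insert_commute linorder_neqE_nat)
    moreover from this have "root_of S = exc_class i - exc_class j" "1 \<le> i" "j \<le> 6"
      using assms 1 r2_eq[of i j] by (auto simp: root_supports_def root_of_def)
    ultimately show thesis
      using that(1) by blast
  next
    case 2
    then show thesis
      using assms that(2) r3_eq[of S] by (auto simp: root_supports_def root_of_def)
  next
    case 3
    then have "S = {1..6}"
      using assms by (intro card_subset_eq) (auto simp: root_supports_def)
    then show thesis
      using that(3) r_all_eq by (simp add: root_of_def)
  qed
qed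

lemma root_in_E: "S \<in> root_supports \<Longrightarrow> root_of S \<in> E"
  by (erule root_supports_cases)
    (auto intro!: subspace_diff subspace_scale subspace_sum subspace_E exc_class_in_E line_class_in_E)

text \<open>
  In \<open>exc_class_inner\<close> the part \<open>1/3\<close> is constant; it is what the coefficient of \<open>line_class\<close> in a root
  compensates, so that only membership in \<open>S\<close> remains.
\<close>
lemma sum_exc_class_inner:
  assumes "S \<subseteq> {1..6}" "i \<in> {1..6}"
  shows "(\<Sum>j\<in>S. exc_class j \<bullet> exc_class i) = (if i \<in> S then 1 else 0) + card S / 3"
proof -
  have "finite S"
    using assms(1) finite_subset by blast
  have "(\<Sum>j\<in>S. exc_class j \<bullet> exc_class i) = (\<Sum>j\<in>S. (if j = i then 1 else 0) + 1/3)"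
    using assms by (intro sum.cong) (auto simp: exc_class_inner)
  also have "\<dots> = (if i \<in> S then 1 else 0) + card S / 3"
    using \<open>finite S\<close> by (simp add: sum.distrib)
  finally show ?thesis .
qed

lemma root_inner_exc_class:
  assumes "S \<in> root_supports" "i \<in> {1..6}"
  shows "root_of S \<bullet> exc_class i \<noteq> 0 \<longleftrightarrow> i \<in> S"
  using assms(1)
proof (cases rule: root_supports_cases)
  case (1 j k)
  then show ?thesis
    using assms(2) by (auto simp: inner_diff_left exc_class_inner)
next
  case 2
  then show ?thesis
    using assms(2) by (simp add: inner_diff_left line_class_inner inner_sum_left sum_exc_class_inner)
next
  case 3
  then show ?thesis
    using assms(2) sum_exc_class_inner[of "{1..6}" i] by (simp add: inner_diff_left line_class_inner inner_sum_left)
qed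

lemma support_root:
  assumes "S \<in> root_supports"
  shows "support (root_of S) = S" "support (- root_of S) = S"
proof -
  have "S \<subseteq> {1..6}"
    using assms by (simp add: root_supports_def)
  then show "support (root_of S) = S" "support (- root_of S) = S"
    using root_inner_exc_class[OF assms] unfolding support_def inner_minus_left neg_equal_0_iff_equal by blast+
qed


section \<open>The reflections on supports\<close>

text \<open>
  The action of a generating reflection on roots up to sign.  The reflection in \<open>r\<^sub>1\<^sub>2\<^sub>3\<close> adds or
  subtracts \<open>r\<^sub>1\<^sub>2\<^sub>3\<close> or fixes the root up to sign; on supports this is the symmetric difference with
  \<open>{1, 2, 3}\<close>, performed exactly when the result is again the support of a root.
\<close>
definition support_act :: "nat \<Rightarrow> nat set \<Rightarrow> nat set" where
  "support_act k S = (if k = 6 then (let T = (S - {1, 2, 3}) \<union> ({1, 2, 3} - S) in if T \<in> root_supports then T else S)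
     else adj_swap k ` S)"

lemma reflection_linear: "linear (reflection a)"
  by unfold_locales
    (simp_all add: reflection_def inner_add_left algebra_simps add_divide_distrib distrib_left)

lemma bij_betw_adj_swap: "k \<in> {1..5} \<Longrightarrow> bij_betw (adj_swap k) {1..6} {1..6}"
  unfolding adj_swap_def by (intro bij_betw_byWitness[where f' = "adj_swap k"]) (auto simp: adj_swap_apply adj_swap_def Transposition.transpose_def)

lemma inj_adj_swap: "inj (adj_swap k)"
  by (simp add: adj_swap_def)

text \<open>
  \<open>s\<^sub>k\<^sub>,\<^sub>k\<^sub>+\<^sub>1\<close> permutes the exceptional classes, as it comes from exchanging two of the blown-up points.
\<close>
lemma reflection_adjacent:
  assumes "k \<in> {1..5}"
  shows "i \<in> {1..6} \<Longrightarrow> reflection (gen_root k) (exc_class i) = exc_class (adj_swap k i)"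
    "reflection (gen_root k) line_class = line_class"
proof -
  have k: "k \<in> {1..6}" "k + 1 \<in> {1..6}" and r: "gen_root k = exc_class k - exc_class (k + 1)"
    using assms r2_eq[of k "k + 1"] by (auto simp: gen_root_def)
  have n: "gen_root k \<bullet> gen_root k = 2"
    using k unfolding r by (simp add: inner_diff_left inner_diff_right exc_class_inner del: atLeastAtMost_iff)
  show "reflection (gen_root k) line_class = line_class"
    using k unfolding reflection_def r by (simp add: inner_diff_right line_class_inner del: atLeastAtMost_iff)
  assume i: "i \<in> {1..6}"
  have "exc_class i \<bullet> gen_root k = (if i = k then 1 else if i = k + 1 then -1 else 0)"
    using i k unfolding r by (simp add: inner_diff_right exc_class_inner del: atLeastAtMost_iff)
  then show "reflection (gen_root k) (exc_class i) = exc_class (adj_swap k i)"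
    unfolding reflection_def n by (simp add: r adj_swap_apply)
qed

text \<open>
  The classical action of a quadratic transformation on the Picard lattice.
\<close>
lemma reflection_cremona:
  shows "i \<in> {1..6} \<Longrightarrow> reflection (gen_root 6) (exc_class i) = (if i \<le> 3 then exc_class i + gen_root 6 else exc_class i)"
    "reflection (gen_root 6) line_class = line_class + gen_root 6"
    "gen_root 6 = line_class - exc_class 1 - exc_class 2 - exc_class 3"
proof -
  show r: "gen_root 6 = line_class - exc_class 1 - exc_class 2 - exc_class 3"
    using r3_eq[of "{1, 2, 3}"] by (simp add: gen_root_def)
  have class_lin: "exc_class j \<bullet> line_class = 1" if "j \<in> {1..6}" for j
    using line_class_inner(2)[OF that] by (simp add: inner_commute)
  have n: "gen_root 6 \<bullet> gen_root 6 = 2"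
    unfolding r by (simp add: inner_diff_left inner_diff_right exc_class_inner line_class_inner class_lin)
  have "line_class \<bullet> gen_root 6 = -1"
    unfolding r by (simp add: inner_diff_right line_class_inner)
  then show "reflection (gen_root 6) line_class = line_class + gen_root 6"
    unfolding reflection_def n by simp
  assume i: "i \<in> {1..6}"
  then have "exc_class i \<bullet> gen_root 6 = (if i \<le> 3 then -1 else 0)"
    unfolding r by (auto simp add: inner_diff_right exc_class_inner line_class_inner class_lin)
  then show "reflection (gen_root 6) (exc_class i) = (if i \<le> 3 then exc_class i + gen_root 6 else exc_class i)"
    unfolding reflection_def n by simp
qed

lemma root_of_pair:
  assumes "i \<noteq> j" "i \<in> {1..6}" "j \<in> {1..6}"
  shows "root_of {i, j} \<in> {exc_class i - exc_class j, - (exc_class i - exc_class j)}"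
proof (cases "i < j")
  case True
  then show ?thesis using assms r2_eq[of i j] by (simp add: root_of_def)
next
  case False
  then show ?thesis using assms r2_eq[of j i] by (simp add: root_of_def insert_commute)
qed

lemma reflection_root_adjacent:
  assumes k: "k \<in> {1..5}" and S: "S \<in> root_supports"
  shows "support_act k S \<in> root_supports"
    "reflection (gen_root k) (root_of S) \<in> {root_of (support_act k S), - root_of (support_act k S)}"
proof -
  note lins = linear_diff[OF reflection_linear] linear_sum[OF reflection_linear] linear_scale[OF reflection_linear]
  have act: "support_act k S = adj_swap k ` S"
    using k by (simp add: support_act_def)
  have sub: "adj_swap k ` S \<subseteq> {1..6}" if "S \<subseteq> {1..6}" for S
    using bij_betw_imp_surj_on[OF bij_betw_adj_swap[OF k]] that by blast
  have card: "card (adj_swap k ` S) = card S" for S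
    by (simp add: card_image inj_on_subset[OF inj_adj_swap])
  have sum: "(\<Sum>i\<in>S. reflection (gen_root k) (exc_class i)) = (\<Sum>i\<in>adj_swap k ` S. exc_class i)" if "S \<subseteq> {1..6}" for S
    using that by (subst sum.reindex) (auto intro!: sum.cong simp: inj_on_subset[OF inj_adj_swap] reflection_adjacent[OF k])
  show "support_act k S \<in> root_supports"
    using S sub[of S] unfolding act by (simp add: root_supports_def card)
  show "reflection (gen_root k) (root_of S) \<in> {root_of (support_act k S), - root_of (support_act k S)}"
    using S
  proof (cases rule: root_supports_cases)
    case (1 i j)
    then have ij: "i \<in> {1..6}" "j \<in> {1..6}" "i \<noteq> j"
      by auto
    then have "adj_swap k i \<noteq> adj_swap k j" "adj_swap k i \<in> {1..6}" "adj_swap k j \<in> {1..6}"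
      using sub[of "{i, j}"] inj_adj_swap[of k] by (auto simp: inj_eq)
    from root_of_pair[OF this] show ?thesis
      using 1(5) ij unfolding act unfolding 1(1)
      by (auto simp: lins reflection_adjacent[OF k] simp del: atLeastAtMost_iff)
  next
    case 2
    then show ?thesis
      unfolding act using r3_eq[of "adj_swap k ` S"] sub[of S]
      by (simp add: lins reflection_adjacent[OF k] sum card root_of_def[of "adj_swap k ` S"])
  next
    case 3
    then show ?thesis
      unfolding act using bij_betw_imp_surj_on[OF bij_betw_adj_swap[OF k]]
      by (simp add: lins reflection_adjacent(2)[OF k] sum del: atLeastAtMost_iff)
  qed
qed

lemma reflection_root_cremona:
  assumes S: "S \<in> root_supports"
  shows "support_act 6 S \<in> root_supports"
    "reflection (gen_root 6) (root_of S) \<in> {root_of (support_act 6 S), - root_of (support_act 6 S)}"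
proof -
  show "support_act 6 S \<in> root_supports"
    using S by (simp add: support_act_def Let_def)
  note lins = linear_diff[OF reflection_linear] linear_sum[OF reflection_linear] linear_scale[OF reflection_linear]
  have tri: "root_of {a, b, c} = line_class - exc_class a - exc_class b - exc_class c" if "1 \<le> a" "a < b" "b < c" "c \<le> 6" for a b c
    using that r3_eq[of "{a, b, c}"] by (simp add: root_of_def)
  have pair: "root_of {a, b} = exc_class a - exc_class b" if "1 \<le> a" "a < b" "b \<le> 6" for a b
    using that r2_eq[of a b] by (simp add: root_of_def)
  have all: "root_of {1,2,3,4,5,6} = 2 *\<^sub>R line_class - exc_class 1 - exc_class 2 - exc_class 3 - exc_class 4 - exc_class 5 - exc_class 6"
    using r_all_eq unfolding one_to_six by (simp add: root_of_def algebra_simps)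
  show "reflection (gen_root 6) (root_of S) \<in> {root_of (support_act 6 S), - root_of (support_act 6 S)}"
    using S
  proof (cases rule: root_supports_cases)
    case (1 i j)
    then have "i \<in> {1,2,3,4,5}" "j \<in> {2,3,4,5,6}"
      by auto
    then show ?thesis using \<open>i < j\<close> unfolding 1(1)
      apply (elim insertE emptyE; hypsubst)
      apply (simp_all add: pair tri all lins reflection_cremona(1,2) support_act_def Let_def
        root_supports_def insert_Diff_if del: One_nat_def)
      apply (simp_all add: reflection_cremona(3) algebra_simps scaleR_2 del: One_nat_def)
      done
  next
    case 2
    show ?thesis
      using triple_cases[OF 2(1,2)]
      apply (elim insertE emptyE; hypsubst)
      apply (simp_all add: pair tri all lins reflection_cremona(1,2) support_act_def Let_def
        root_supports_def insert_Diff_if del: One_nat_def)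
      apply (simp_all add: reflection_cremona(3) algebra_simps scaleR_2 del: One_nat_def)
      done
  next
    case 3
    show ?thesis
      unfolding 3(1) unfolding one_to_six
      apply (simp_all add: pair tri all lins reflection_cremona(1,2) support_act_def Let_def
        root_supports_def insert_Diff_if del: One_nat_def)
      apply (simp_all add: reflection_cremona(3) algebra_simps scaleR_2 del: One_nat_def)
      done
  qed
qed

lemma reflection_root_of:
  assumes "k \<in> {1..6}" "S \<in> root_supports"
  shows "support_act k S \<in> root_supports"
    "reflection (gen_root k) (root_of S) \<in> {root_of (support_act k S), - root_of (support_act k S)}"
proof -
  have "k \<in> {1..5} \<or> k = 6"
    using assms(1) by auto
  then show "support_act k S \<in> root_supports"
    "reflection (gen_root k) (root_of S) \<in> {root_of (support_act k S), - root_of (support_act k S)}"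
    using reflection_root_adjacent reflection_root_cremona assms(2) by blast+
qed


section \<open>Labels as sets of supports\<close>

definition roots_on :: "nat set set \<Rightarrow> (real^8) set" where
  "roots_on X = pm (root_of ` X)"

lemma s_refl_roots_on:
  assumes k: "k \<in> {1..6}" and X: "X \<subseteq> root_supports"
  shows "s_refl k ` roots_on X = roots_on (support_act k ` X)"
proof -
  have E: "root_of S \<in> E" "- root_of S \<in> E" if "S \<in> X" for S
    using root_in_E that X subspace_neg[OF subspace_E] by blast+
  have "s_refl k ` {root_of S, - root_of S} = {root_of (support_act k S), - root_of (support_act k S)}"
    if "S \<in> X" for S
  proof -
    have "s_refl k (root_of S) = reflection (gen_root k) (root_of S)"
      "s_refl k (- root_of S) = - reflection (gen_root k) (root_of S)"
      using E[OF that] by (simp_all add: s_refl_def linear_neg[OF reflection_linear])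
    moreover have "reflection (gen_root k) (root_of S) = root_of (support_act k S)
        \<or> reflection (gen_root k) (root_of S) = - root_of (support_act k S)"
      using reflection_root_of(2)[OF k, of S] that X by blast
    ultimately show ?thesis
      by auto
  qed
  moreover have "roots_on Y = (\<Union>S\<in>Y. {root_of S, - root_of S})" for Y
    by (auto simp: roots_on_def pm_def)
  ultimately show ?thesis
    by (simp add: image_UN)
qed

lemma support_roots_on:
  assumes "X \<subseteq> root_supports"
  shows "support ` roots_on X = X"
proof -
  have "support ` roots_on X = (support \<circ> root_of) ` X \<union> (\<lambda>S. support (- root_of S)) ` X"
    by (auto simp: roots_on_def pm_def image_Un image_image)
  also have "\<dots> = X \<union> X"
    using assms by (intro arg_cong2[of _ _ _ _ "(\<union>)"]) (force simp: support_root)+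
  finally show ?thesis by simp
qed

text \<open>
  The triple of \<open>A\<^sub>2\<close>-subsystems of a label, with every pair of opposite roots replaced by its support.
  It turns the action of the group on labels into a computation with small sets of numbers.
\<close>
fun label_supports :: "label \<Rightarrow> nat set set set" where
  "label_supports (Tri T) = {{{i, j} | i j. i \<in> S \<and> j \<in> S \<and> i \<noteq> j} | S. S \<in> T} \<union> {insert {1..6} T}"
| "label_supports (Cyc C) = {insert p {{i} \<union> q | i. i \<in> p} | p q. (p, q) \<in> C}"

lemma pairs_of_triple:
  assumes "distinct [a, b, c]"
  shows "{f {i, j} | i j. i \<in> {a, b, c} \<and> j \<in> {a, b, c} \<and> i \<noteq> j} = {f {a, b}, f {a, c}, f {b, c}}"
proof
  have ne: "a \<noteq> b" "a \<noteq> c" "b \<noteq> c"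
    using assms by auto
  show "{f {i, j} | i j. i \<in> {a, b, c} \<and> j \<in> {a, b, c} \<and> i \<noteq> j} \<subseteq> {f {a, b}, f {a, c}, f {b, c}}"
    by (auto simp: insert_commute)
  show "{f {a, b}, f {a, c}, f {b, c}} \<subseteq> {f {i, j} | i j. i \<in> {a, b, c} \<and> j \<in> {a, b, c} \<and> i \<noteq> j}"
    using ne by blast
qed

lemma setcompr_of_pair: "{F S | S. S \<in> {P, R}} = {F P, F R}"
  by blast

lemma setcompr_of_arrows:
  "{F p q | p q. (p, q) \<in> {(p1, q1), (p2, q2), (p3, q3)}} = {F p1 q1, F p2 q2, F p3 q3}"
  by blast

lemma label_supports_tri:
  assumes "{a, b, c, d, e, f} = {1..6}"
  shows "label_supports (tri a b c d e f) =
    {{{a, b}, {a, c}, {b, c}}, {{d, e}, {d, f}, {e, f}}, {{1..6}, {a, b, c}, {d, e, f}}}"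
proof -
  have "distinct [a, b, c]" "distinct [d, e, f]"
    using distinct_if_six[OF assms] by auto
  note p = this[THEN pairs_of_triple[where f = "\<lambda>S. S"]]
  have "label_supports (tri a b c d e f) = {{{i, j} | i j. i \<in> {a, b, c} \<and> j \<in> {a, b, c} \<and> i \<noteq> j},
    {{i, j} | i j. i \<in> {d, e, f} \<and> j \<in> {d, e, f} \<and> i \<noteq> j}} \<union> {{{1..6}, {a, b, c}, {d, e, f}}}"
    unfolding tri_def label_supports.simps
      setcompr_of_pair[of "\<lambda>S. {{i, j} | i j. i \<in> S \<and> j \<in> S \<and> i \<noteq> j}"] by (rule refl)
  then show ?thesis
    unfolding p Un_insert_left Un_empty_left .
qed

lemma label_supports_cyc:
  "label_supports (cyc a b c d e f) =
    {{{a, b}, {a, c, d}, {b, c, d}}, {{c, d}, {c, e, f}, {d, e, f}}, {{e, f}, {e, a, b}, {f, a, b}}}"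
  unfolding cyc_def label_supports.simps setcompr_of_arrows[of "\<lambda>p q. insert p {{i} \<union> q | i. i \<in> p}"]
    setcompr_of_pair
  unfolding Un_insert_left Un_empty_left by (rule refl)

lemma root_of_pair_eq: "a \<noteq> b \<Longrightarrow> root_of {a, b} = r2 {a, b}"
  by (simp add: root_of_def)

lemma root_of_triple_eq: "distinct [a, b, c] \<Longrightarrow> root_of {a, b, c} = r3 {a, b, c}"
  by (simp add: root_of_def)

lemma A2_triple_tri:
  assumes "{a, b, c, d, e, f} = {1..6}"
  shows "A2_triple (tri a b c d e f) = roots_on ` label_supports (tri a b c d e f)"
proof -
  have d: "distinct [a, b, c, d, e, f]"
    using distinct_if_six[OF assms] .
  then have "distinct [a, b, c]" "distinct [d, e, f]"
    by auto
  note p = this[THEN pairs_of_triple[where f = r2]]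
  have r: "root_of {1..6} = r_all"
    by (simp add: root_of_def)
  have "A2_triple (tri a b c d e f) = {pm {r2 {i, j} | i j. i \<in> {a, b, c} \<and> j \<in> {a, b, c} \<and> i \<noteq> j},
    pm {r2 {i, j} | i j. i \<in> {d, e, f} \<and> j \<in> {d, e, f} \<and> i \<noteq> j}}
    \<union> {pm ({r_all} \<union> r3 ` {{a, b, c}, {d, e, f}})}"
    unfolding tri_def A2_triple.simps
      setcompr_of_pair[of "\<lambda>S. pm {r2 {i, j} | i j. i \<in> S \<and> j \<in> S \<and> i \<noteq> j}"] by (rule refl)
  also have "\<dots> = roots_on ` label_supports (tri a b c d e f)"
    unfolding p label_supports_tri[OF assms] roots_on_def image_insert image_empty r
    using d by (simp add: root_of_pair_eq root_of_triple_eq insert_commute)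
  finally show ?thesis .
qed

lemma A2_triple_cyc:
  assumes "{a, b, c, d, e, f} = {1..6}"
  shows "A2_triple (cyc a b c d e f) = roots_on ` label_supports (cyc a b c d e f)"
proof -
  \<comment> \<open>The reversed list provides the inequalities in the other orientation for the simplifier.\<close>
  have d: "distinct [a, b, c, d, e, f]" "distinct [f, e, d, c, b, a]"
    using distinct_if_six[OF assms] by auto
  have "A2_triple (cyc a b c d e f) = {pm ({r2 {a, b}} \<union> {r3 ({i} \<union> {c, d}) | i. i \<in> {a, b}}),
    pm ({r2 {c, d}} \<union> {r3 ({i} \<union> {e, f}) | i. i \<in> {c, d}}),
    pm ({r2 {e, f}} \<union> {r3 ({i} \<union> {a, b}) | i. i \<in> {e, f}})}"
    unfolding cyc_def A2_triple.simps
      setcompr_of_arrows[of "\<lambda>p q. pm ({r2 p} \<union> {r3 ({i} \<union> q) | i. i \<in> p})"] by (rule refl)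
  also have "\<dots> = roots_on ` label_supports (cyc a b c d e f)"
    unfolding label_supports_cyc roots_on_def setcompr_of_pair unfolding Un_insert_left Un_empty_left
    using d by (simp add: root_of_pair_eq root_of_triple_eq)
  finally show ?thesis .
qed

lemma label_cases:
  assumes "\<alpha> \<in> labels"
  obtains (tri) a b c d e f where "\<alpha> = tri a b c d e f" "{a, b, c, d, e, f} = {1..6}"
  | (cyc) a b c d e f where "\<alpha> = cyc a b c d e f" "{a, b, c, d, e, f} = {1..6}"
  using assms unfolding labels_def by blast

lemma label_supports_subset:
  assumes "\<alpha> \<in> labels" "X \<in> label_supports \<alpha>"
  shows "X \<subseteq> root_supports"
  using assms(1)
proof (cases rule: label_cases)
  case (tri a b c d e f)
  have "distinct [a, b, c, d, e, f]" "a \<in> {1..6}" "b \<in> {1..6}" "c \<in> {1..6}" "d \<in> {1..6}" "e \<in> {1..6}" "f \<in> {1..6}"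
    using distinct_if_six[OF tri(2)] tri(2) by blast+
  then show ?thesis
    using assms(2) unfolding tri(1) label_supports_tri[OF tri(2)]
    by (elim insertE emptyE) (simp_all add: root_supports_def)
next
  case (cyc a b c d e f)
  have "distinct [a, b, c, d, e, f]" "distinct [f, e, d, c, b, a]"
    using distinct_if_six[OF cyc(2)] by auto
  moreover have "a \<in> {1..6}" "b \<in> {1..6}" "c \<in> {1..6}" "d \<in> {1..6}" "e \<in> {1..6}" "f \<in> {1..6}"
    using cyc(2) by blast+
  ultimately show ?thesis
    using assms(2) unfolding cyc(1) label_supports_cyc
    by (elim insertE emptyE) (simp_all add: root_supports_def)
qed

lemma A2_triple_eq:
  assumes "\<alpha> \<in> labels"
  shows "A2_triple \<alpha> = roots_on ` label_supports \<alpha>"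
  using assms by (cases rule: label_cases) (simp_all add: A2_triple_tri A2_triple_cyc)

text \<open>
  The label is recovered from the supports.  The support \<open>{1..6}\<close> occurs only for the labels \<open>(abc,def)\<close>,
  and then the two triples are the supports with three elements.  An arrow \<open>ab \<rightarrow> cd\<close> contributes
  \<open>{ab, acd, bcd}\<close>: its source is the only pair, its target the intersection of the triples.
\<close>
lemma inj_label_supports: "inj_on label_supports labels"
proof (rule inj_on_inverseI)
  define arrow :: "nat set set \<Rightarrow> nat set \<times> nat set"
    where "arrow X = (\<Union>{S \<in> X. card S = 2}, \<Inter>{S \<in> X. card S = 3})" for X
  define label_of where "label_of Z = (if {1..6} \<in> \<Union>Z then Tri {S \<in> \<Union>Z. card S = 3}
    else Cyc (arrow ` Z))" for Z :: "nat set set set"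
  fix \<alpha> assume "\<alpha> \<in> labels"
  then show "label_of (label_supports \<alpha>) = \<alpha>"
  proof (cases rule: label_cases)
    case (tri a b c d e f)
    have "distinct [a, b, c, d, e, f]"
      using distinct_if_six[OF tri(2)] .
    then have "{S \<in> \<Union>(label_supports \<alpha>). card S = 3} = {{a, b, c}, {d, e, f}}"
      unfolding tri(1) label_supports_tri[OF tri(2)] by auto
    then show ?thesis
      unfolding label_of_def tri(1) label_supports_tri[OF tri(2)] by (simp add: tri_def)
  next
    case (cyc a b c d e f)
    have d: "distinct [a, b, c, d, e, f]" "distinct [f, e, d, c, b, a]"
      using distinct_if_six[OF cyc(2)] by auto
    have arrow_eq: "arrow {{i, j}, {i, k, l}, {j, k, l}} = ({i, j}, {k, l})" if "distinct [i, j, k, l]" for i j k l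
    proof -
      have "{S \<in> {{i, j}, {i, k, l}, {j, k, l}}. card S = 2} = {{i, j}}"
        "{S \<in> {{i, j}, {i, k, l}, {j, k, l}}. card S = 3} = {{i, k, l}, {j, k, l}}"
        "\<Inter>{{i, k, l}, {j, k, l}} = {k, l}"
        using that by auto
      then show ?thesis
        unfolding arrow_def by simp
    qed
    have "card S \<noteq> 6" if "S \<in> \<Union>(label_supports \<alpha>)" for S
      using that d unfolding cyc(1) label_supports_cyc by auto
    then have "{1..6} \<notin> \<Union>(label_supports \<alpha>)"
      by fastforce
    then show ?thesis
      unfolding label_of_def cyc(1) label_supports_cyc
      using d by (simp add: arrow_eq cyc_def)
  qed
qed

text \<open>
  The supports can be read off from the triple of \<open>A\<^sub>2\<close>-subsystems by inner products with the exceptional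
  classes.  Injectivity makes the description in \<open>label_act\<close> unambiguous.
\<close>
lemma inj_A2_triple: "inj_on A2_triple labels"
proof (rule inj_onI)
  fix \<alpha> \<beta> assume l: "\<alpha> \<in> labels" "\<beta> \<in> labels" and eq: "A2_triple \<alpha> = A2_triple \<beta>"
  have "image support ` A2_triple \<gamma> = label_supports \<gamma>" if "\<gamma> \<in> labels" for \<gamma>
  proof -
    have "image support ` A2_triple \<gamma> = (\<lambda>X. support ` roots_on X) ` label_supports \<gamma>"
      using A2_triple_eq[OF that] by (simp add: image_image)
    also have "\<dots> = (\<lambda>X. X) ` label_supports \<gamma>"
      using label_supports_subset[OF that] by (intro image_cong support_roots_on) auto
    finally show ?thesis by simp
  qed
  then show "\<alpha> = \<beta>"
    using l eq inj_label_supports by (metis inj_onD)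
qed

lemma label_act_eqI:
  assumes k: "k \<in> {1..6}" and \<alpha>: "\<alpha> \<in> labels" and \<beta>: "\<beta> \<in> labels"
    and eq: "label_supports \<beta> = image (support_act k) ` label_supports \<alpha>"
  shows "label_act (s_refl k) \<alpha> = \<beta>"
proof -
  have "A2_triple \<beta> = (\<lambda>X. roots_on (support_act k ` X)) ` label_supports \<alpha>"
    using A2_triple_eq[OF \<beta>] eq by (simp add: image_image)
  also have "\<dots> = (\<lambda>X. s_refl k ` roots_on X) ` label_supports \<alpha>"
    using label_supports_subset[OF \<alpha>] by (intro image_cong refl s_refl_roots_on[OF k, symmetric]) auto
  also have "\<dots> = image (s_refl k) ` A2_triple \<alpha>"
    using A2_triple_eq[OF \<alpha>] by (simp add: image_image)
  finally have "A2_triple \<beta> = image (s_refl k) ` A2_triple \<alpha>" .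
  then show ?thesis
    unfolding label_act_def using \<beta>
    by (intro the_equality) (simp, rule inj_onD[OF inj_A2_triple], simp_all)
qed


section \<open>Exchanging two neighbouring points\<close>

text \<open>
  The common factor of all 80 coordinates under a generator.  Every \<open>y\<^sub>\<alpha>\<close> has degree 6 in \<open>det A\<close> and
  degree 3 in each column, so for \<open>k \<le> 5\<close> it is multiplied by \<open>(det A)\<^sup>6 (t\<^sub>1 \<cdots> t\<^sub>6)\<^sup>3\<close>; since the factor
  stands on the side of \<open>s_map k x\<close>, the inverse appears.
\<close>
definition multiplier :: "nat \<Rightarrow> complex^4 \<Rightarrow> complex" where
  "multiplier k x = (if k = 6 then (cremona_weight x)\<^sup>2
     else 1 / (row_det k x ^ 6 * (\<Prod>i\<in>{1..6}. column_scale k x i) ^ 3))"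

lemma tri_in_labels: "{a, b, c, d, e, f} = {1..6} \<Longrightarrow> tri a b c d e f \<in> labels"
  unfolding labels_def by blast

lemma cyc_in_labels: "{a, b, c, d, e, f} = {1..6} \<Longrightarrow> cyc a b c d e f \<in> labels"
  unfolding labels_def by blast

lemma label_cases_containing:
  assumes "\<alpha> \<in> labels" "p \<in> {1..6}"
  obtains (tri) b c d e f where "\<alpha> = tri p b c d e f" "{p, b, c, d, e, f} = {1..6}"
  | (cyc) b c d e f where "\<alpha> = cyc p b c d e f" "{p, b, c, d, e, f} = {1..6}"
  using assms(1)
proof (cases rule: label_cases)
  case t: (tri a b c d e f)
  then have "p \<in> {a, b, c, d, e, f}"
    using assms(2) by simp
  then consider "p = a" | "p = b" | "p = c" | "p = d" | "p = e" | "p = f"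
    by blast
  then show thesis
  proof cases
    case 1 then show thesis using tri[of b c d e f] t by simp
  next
    case 2 then show thesis using tri[of a c d e f] t by (simp add: tri_def insert_commute)
  next
    case 3 then show thesis using tri[of b a d e f] t by (simp add: tri_def insert_commute)
  next
    case 4 then show thesis using tri[of e f a b c] t by (simp add: tri_def insert_commute)
  next
    case 5 then show thesis using tri[of d f a b c] t by (simp add: tri_def insert_commute)
  next
    case 6 then show thesis using tri[of e d a b c] t by (simp add: tri_def insert_commute)
  qed
next
  case t: (cyc a b c d e f)
  then have "p \<in> {a, b, c, d, e, f}"
    using assms(2) by simp
  then consider "p = a" | "p = b" | "p = c" | "p = d" | "p = e" | "p = f"
    by blast
  then show thesis
  proof cases
    case 1 then show thesis using cyc[of b c d e f] t by simp
  next
    case 2 then show thesis using cyc[of a c d e f] t by (simp add: cyc_def insert_commute)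
  next
    case 3 then show thesis using cyc[of d e f a b] t by (simp add: cyc_def insert_commute)
  next
    case 4 then show thesis using cyc[of c e f a b] t by (simp add: cyc_def insert_commute)
  next
    case 5 then show thesis using cyc[of f a b c d] t by (simp add: cyc_def insert_commute)
  next
    case 6 then show thesis using cyc[of e a b c d] t by (simp add: cyc_def insert_commute)
  qed
qed

text \<open>
  The relative positions of two indices in a label, up to the identifications among labels.  For the
  indices \<open>k\<close> and \<open>k + 1\<close> these are the cases in which the sign of a transposition has to be determined.
\<close>
lemma label_cases_two:
  assumes "\<alpha> \<in> labels" "p \<in> {1..6}" "q \<in> {1..6}" "p \<noteq> q"
  obtains (tri_same) c d e f where "\<alpha> = tri p q c d e f" "{p, q, c, d, e, f} = {1..6}"
  | (tri_split) b c e f where "\<alpha> = tri p b c q e f" "{p, b, c, q, e, f} = {1..6}"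
  | (cyc_same) c d e f where "\<alpha> = cyc p q c d e f" "{p, q, c, d, e, f} = {1..6}"
  | (cyc_next) b d e f where "\<alpha> = cyc p b q d e f" "{p, b, q, d, e, f} = {1..6}"
  | (cyc_prev) b c d f where "\<alpha> = cyc p b c d q f" "{p, b, c, d, q, f} = {1..6}"
  using assms(1,2)
proof (cases rule: label_cases_containing)
  case (tri b c d e f)
  then have "q \<in> {p, b, c, d, e, f}"
    using assms(3) by simp
  then consider "q = b" | "q = c" | "q = d" | "q = e" | "q = f"
    using assms(4) by blast
  then show thesis
  proof cases
    case 1 then show thesis using tri_same tri by blast
  next
    case 2 then show thesis
      using tri_same[of b d e f] tri by (simp add: tri_def insert_commute)
  next
    case 3 then show thesis using tri_split tri by blast
  next
    case 4 then show thesis using tri_split[of b c d f] tri by (simp add: tri_def insert_commute)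
  next
    case 5 then show thesis using tri_split[of b c e d] tri by (simp add: tri_def insert_commute)
  qed
next
  case (cyc b c d e f)
  then have "q \<in> {p, b, c, d, e, f}"
    using assms(3) by simp
  then consider "q = b" | "q = c" | "q = d" | "q = e" | "q = f"
    using assms(4) by blast
  then show thesis
  proof cases
    case 1 then show thesis using cyc_same cyc by blast
  next
    case 2 then show thesis using cyc_next cyc by blast
  next
    case 3 then show thesis using cyc_next[of b c e f] cyc by (simp add: cyc_def insert_commute)
  next
    case 4 then show thesis using cyc_prev cyc by blast
  next
    case 5 then show thesis using cyc_prev[of b c d e] cyc by (simp add: cyc_def insert_commute)
  qed
qed

text \<open>
  The sign convention of the action: a generator keeps the coordinate of a fixed label, and passes to
  the coordinate of opposite sign when it moves the label.  So it suffices to compare the polynomials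
  \<open>y_lab\<close> themselves, up to this sign.
\<close>
lemma gen_perm_fixed:
  assumes "\<alpha> \<in> labels" "label_act (s_refl k) \<alpha> = \<alpha>" "y_lab \<alpha> X = c * y_lab \<alpha> Y"
  shows "gen_perm k (Pos \<alpha>) \<in> coords \<and> y_poly (gen_perm k (Pos \<alpha>)) X = c * y_poly (Pos \<alpha>) Y"
  using assms by (simp add: coords_def)

lemma gen_perm_moved:
  assumes "\<beta> \<in> labels" "label_act (s_refl k) \<alpha> = \<beta>" "\<beta> \<noteq> \<alpha>" "y_lab \<beta> X = - (c * y_lab \<alpha> Y)"
  shows "gen_perm k (Pos \<alpha>) \<in> coords \<and> y_poly (gen_perm k (Pos \<alpha>)) X = c * y_poly (Pos \<alpha>) Y"
  using assms by (simp add: coords_def)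

lemma scales_nonzero:
  assumes "x \<in> M"
  shows "row_det k x \<noteq> 0" "column_scale k x i \<noteq> 0"
  using M_nonzero[OF assms] by (auto simp: row_det_def column_scale_def)

lemma minor_s_map_triple:
  assumes "x \<in> M" "k \<in> {1..5}" "distinct [a, b, c]" "a \<in> {1..6}" "b \<in> {1..6}" "c \<in> {1..6}"
  shows "minor {a, b, c} (mat_of (s_map k x)) =
    (if {k, k + 1} \<subseteq> {a, b, c} then -1 else 1) * row_det k x
     * (column_scale k x a * column_scale k x b * column_scale k x c)
     * minor {adj_swap k a, adj_swap k b, adj_swap k c} (mat_of x)"
  using minor_s_map[OF assms(1,2), of "{a, b, c}"] assms(3-6) by (simp add: mult.assoc)

text \<open>
  It remains to count signs.  For \<open>(abc,def)\<close> the factor \<open>Q\<close> always changes sign, and one of the two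
  minors does if \<open>k\<close> and \<open>k + 1\<close> lie in the same triple: the total sign is \<open>+\<close> exactly if the label is fixed.
  For \<open>(ab,cd,ef)\<close>, if \<open>k\<close> and \<open>k + 1\<close> form one of the pairs, they occur together in exactly two of the six
  minors, and the label is fixed.  Otherwise they lie in consecutive pairs of the cycle and occur together
  in exactly one minor, and the label moves.
\<close>
lemma transposition_step:
  assumes x: "x \<in> M" and k: "k \<in> {1..5}" and \<alpha>: "\<alpha> \<in> labels"
  shows "gen_perm k (Pos \<alpha>) \<in> coords \<and> y_poly (gen_perm k (Pos \<alpha>)) (mat_of x) =
    multiplier k x * y_poly (Pos \<alpha>) (mat_of (s_map k x))"
proof -
  define q where "q = k + 1"
  define t where "t = column_scale k x"
  define D where "D = row_det k x"
  have pq: "k \<in> {1..6}" "q \<in> {1..6}" "k \<noteq> q"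
    using k by (auto simp: q_def)
  have nz: "D \<noteq> 0" "t i \<noteq> 0" for i
    unfolding D_def t_def using scales_nonzero[OF x] by blast+
  have adj_swap: "adj_swap k k = q" "adj_swap k q = k" "i \<noteq> k \<Longrightarrow> i \<noteq> q \<Longrightarrow> adj_swap k i = i" for i
    by (auto simp: adj_swap_apply q_def)
  have act: "support_act k = image (adj_swap k)"
    using k by (auto simp: support_act_def)
  have six: "adj_swap k ` {1..6} = {1..6}"
    using bij_betw_imp_surj_on[OF bij_betw_adj_swap[OF k]] .
  note m = minor_s_map_triple[OF x k, folded q_def D_def t_def]
  note Qm = Q_s_map[OF x k, folded D_def t_def]
  have mult: "multiplier k x = 1 / (D ^ 6 * (\<Prod>i\<in>{1..6}. t i) ^ 3)"
    using k by (auto simp: multiplier_def D_def t_def)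
  show ?thesis
    using \<alpha> pq
  proof (cases rule: label_cases_two)
    case (tri_same c d e f)
    note six_set = tri_same(2)
    have d: "distinct [k, q, c, d, e, f]" "distinct [f, e, d, c, q, k]"
      using distinct_if_six[OF six_set] by auto
    have mem: "k \<in> {1..6}" "q \<in> {1..6}" "c \<in> {1..6}" "d \<in> {1..6}" "e \<in> {1..6}" "f \<in> {1..6}"
      using six_set by blast+
    have T: "(\<Prod>i\<in>{1..6}. t i) = t k * t q * t c * t d * t e * t f"
      unfolding six_set[symmetric] using d by (simp add: mult.assoc)
    have "label_act (s_refl k) \<alpha> = \<alpha>"
      using d by (intro label_act_eqI[OF pq(1) \<alpha> \<alpha>])
        (simp add: tri_same(1) label_supports_tri[OF six_set] act six adj_swap insert_commute del: One_nat_def)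
    moreover have "y_lab \<alpha> (mat_of x) = multiplier k x * y_lab \<alpha> (mat_of (s_map k x))"
      unfolding tri_same(1) y_lab_tri[OF six_set] Qm mult T
      using d mem nz by (simp add: m adj_swap insert_commute) (simp add: field_simps eval_nat_numeral)?
    ultimately show ?thesis
      by (rule gen_perm_fixed[OF \<alpha>])
  next
    case (tri_split b c e f)
    note six_set = tri_split(2)
    have d: "distinct [k, b, c, q, e, f]" "distinct [f, e, q, c, b, k]"
      using distinct_if_six[OF six_set] by auto
    have mem: "k \<in> {1..6}" "b \<in> {1..6}" "c \<in> {1..6}" "q \<in> {1..6}" "e \<in> {1..6}" "f \<in> {1..6}"
      using six_set by blast+
    have T: "(\<Prod>i\<in>{1..6}. t i) = t k * t b * t c * t q * t e * t f"
      unfolding six_set[symmetric] using d by (simp add: mult.assoc)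
    have six_set': "{q, b, c, k, e, f} = {1..6}"
      using six_set by (simp add: insert_commute)
    have "label_act (s_refl k) \<alpha> = tri q b c k e f"
      using d by (intro label_act_eqI[OF pq(1) \<alpha> tri_in_labels[OF six_set']])
        (simp add: tri_split(1) label_supports_tri[OF six_set] label_supports_tri[OF six_set'] act six adj_swap insert_commute del: One_nat_def)
    moreover have "tri q b c k e f \<noteq> \<alpha>"
    proof
      assume "tri q b c k e f = \<alpha>"
      then have "{q, b, c} \<in> {{k, b, c}, {q, e, f}}"
        unfolding tri_split(1) tri_def label.inject by (metis insertI1)
      then have "q \<in> {k, b, c} \<or> b \<in> {q, e, f}"
        by blast
      then show False
        using d by simp
    qed
    moreover have "y_lab (tri q b c k e f) (mat_of x) = - (multiplier k x * y_lab \<alpha> (mat_of (s_map k x)))"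
      unfolding tri_split(1) y_lab_tri[OF six_set] y_lab_tri[OF six_set'] Qm mult T
      using d mem nz by (simp add: m adj_swap insert_commute) (simp add: field_simps eval_nat_numeral)?
    ultimately show ?thesis
      by (rule gen_perm_moved[OF tri_in_labels[OF six_set']])
  next
    case (cyc_same c d e f)
    note six_set = cyc_same(2)
    have d: "distinct [k, q, c, d, e, f]" "distinct [f, e, d, c, q, k]"
      using distinct_if_six[OF six_set] by auto
    have mem: "k \<in> {1..6}" "q \<in> {1..6}" "c \<in> {1..6}" "d \<in> {1..6}" "e \<in> {1..6}" "f \<in> {1..6}"
      using six_set by blast+
    have T: "(\<Prod>i\<in>{1..6}. t i) = t k * t q * t c * t d * t e * t f"
      unfolding six_set[symmetric] using d by (simp add: mult.assoc)
    have "label_act (s_refl k) \<alpha> = \<alpha>"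
      using d by (intro label_act_eqI[OF pq(1) \<alpha> \<alpha>])
        (simp add: cyc_same(1) label_supports_cyc act six adj_swap insert_commute del: One_nat_def)
    moreover have "y_lab \<alpha> (mat_of x) = multiplier k x * y_lab \<alpha> (mat_of (s_map k x))"
      unfolding cyc_same(1) y_lab_cyc[OF six_set] Qm mult T
      using d mem nz by (simp add: m adj_swap insert_commute) (simp add: field_simps eval_nat_numeral)?
    ultimately show ?thesis
      by (rule gen_perm_fixed[OF \<alpha>])
  next
    case (cyc_next b d e f)
    note six_set = cyc_next(2)
    have d: "distinct [k, b, q, d, e, f]" "distinct [f, e, d, q, b, k]"
      using distinct_if_six[OF six_set] by auto
    have mem: "k \<in> {1..6}" "b \<in> {1..6}" "q \<in> {1..6}" "d \<in> {1..6}" "e \<in> {1..6}" "f \<in> {1..6}"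
      using six_set by blast+
    have T: "(\<Prod>i\<in>{1..6}. t i) = t k * t b * t q * t d * t e * t f"
      unfolding six_set[symmetric] using d by (simp add: mult.assoc)
    have six_set': "{q, b, k, d, e, f} = {1..6}"
      using six_set by (simp add: insert_commute)
    have "label_act (s_refl k) \<alpha> = cyc q b k d e f"
      using d by (intro label_act_eqI[OF pq(1) \<alpha> cyc_in_labels[OF six_set']])
        (simp add: cyc_next(1) label_supports_cyc act six adj_swap insert_commute del: One_nat_def)
    moreover have "cyc q b k d e f \<noteq> \<alpha>"
    proof
      assume "cyc q b k d e f = \<alpha>"
      then have "({q, b}, {k, d}) \<in> {({k, b}, {q, d}), ({q, d}, {e, f}), ({e, f}, {k, b})}"
        unfolding cyc_next(1) cyc_def label.inject by (metis insertI1)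
      then show False
        using d by (simp add: doubleton_eq_iff)
    qed
    moreover have "y_lab (cyc q b k d e f) (mat_of x) = - (multiplier k x * y_lab \<alpha> (mat_of (s_map k x)))"
      unfolding cyc_next(1) y_lab_cyc[OF six_set] y_lab_cyc[OF six_set'] Qm mult T
      using d mem nz by (simp add: m adj_swap insert_commute) (simp add: field_simps eval_nat_numeral)?
    ultimately show ?thesis
      by (rule gen_perm_moved[OF cyc_in_labels[OF six_set']])
  next
    case (cyc_prev b c d f)
    note six_set = cyc_prev(2)
    have d: "distinct [k, b, c, d, q, f]" "distinct [f, q, d, c, b, k]"
      using distinct_if_six[OF six_set] by auto
    have mem: "k \<in> {1..6}" "b \<in> {1..6}" "c \<in> {1..6}" "d \<in> {1..6}" "q \<in> {1..6}" "f \<in> {1..6}"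
      using six_set by blast+
    have T: "(\<Prod>i\<in>{1..6}. t i) = t k * t b * t c * t d * t q * t f"
      unfolding six_set[symmetric] using d by (simp add: mult.assoc)
    have six_set': "{q, b, c, d, k, f} = {1..6}"
      using six_set by (simp add: insert_commute)
    have "label_act (s_refl k) \<alpha> = cyc q b c d k f"
      using d by (intro label_act_eqI[OF pq(1) \<alpha> cyc_in_labels[OF six_set']])
        (simp add: cyc_prev(1) label_supports_cyc act six adj_swap insert_commute del: One_nat_def)
    moreover have "cyc q b c d k f \<noteq> \<alpha>"
    proof
      assume "cyc q b c d k f = \<alpha>"
      then have "({q, b}, {c, d}) \<in> {({k, b}, {c, d}), ({c, d}, {q, f}), ({q, f}, {k, b})}"
        unfolding cyc_prev(1) cyc_def label.inject by (metis insertI1)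
      then show False
        using d by (simp add: doubleton_eq_iff)
    qed
    moreover have "y_lab (cyc q b c d k f) (mat_of x) = - (multiplier k x * y_lab \<alpha> (mat_of (s_map k x)))"
      unfolding cyc_prev(1) y_lab_cyc[OF six_set] y_lab_cyc[OF six_set'] Qm mult T
      using d mem nz by (simp add: m adj_swap insert_commute) (simp add: field_simps eval_nat_numeral)?
    ultimately show ?thesis
      by (rule gen_perm_moved[OF cyc_in_labels[OF six_set']])
  qed
qed


section \<open>The Cremona transformation\<close>

text \<open>
  The five orbits of \<open>S\<^sub>3 \<times> S\<^sub>3\<close>, permuting the base points 1, 2, 3 and the other points 4, 5, 6, on the
  labels; they have 1, 9, 9, 9 and 12 elements.
\<close>
lemma label_cases_cremona:
  assumes "\<alpha> \<in> labels"
  obtains a b c d e f where "{a, b, c} = {1, 2, 3}" "{d, e, f} = {4, 5, 6}"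
    "\<alpha> \<in> {tri a b c d e f, tri a b d c e f, cyc a b c d e f, cyc a b e f c d, cyc a d b e c f}"
proof -
  have rest: "{u, v, w} = {4, 5, 6}" if "{1, 2, 3, u, v, w} = {1..6}" for u v w :: nat
  proof -
    have "distinct [1, 2, 3, u, v, w]"
      using distinct_if_six[OF that] .
    then have "{u, v, w} = {1, 2, 3, u, v, w} - {1, 2, 3}"
      by auto
    also have "\<dots> = {4, 5, 6}"
      unfolding that by auto
    finally show ?thesis .
  qed
  have p: "1 \<in> {1..6::nat}" "2 \<in> {1..6::nat}" "1 \<noteq> (2::nat)"
    by simp_all
  show thesis
    using assms p
  proof (cases rule: label_cases_two)
    case (tri_same c d e f)
    have s: "{1, 2, c, d, e, f} = {1..6}"
      using tri_same(2) by (simp add: insert_commute)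
    then have "3 \<in> {1, 2, c, d, e, f}"
      by simp
    then consider "c = 3" | "d = 3" | "e = 3" | "f = 3"
      by auto
    then show thesis
    proof cases
      case 1
      then show thesis
        using that[of 1 2 3 d e f] rest[of d e f] s tri_same(1) by (simp add: tri_def insert_commute)
    next
      case 2
      then show thesis
        using that[of 1 2 3 c e f] rest[of c e f] s tri_same(1) by (simp add: tri_def insert_commute)
    next
      case 3
      then show thesis
        using that[of 1 2 3 c d f] rest[of c d f] s tri_same(1) by (simp add: tri_def insert_commute)
    next
      case 4
      then show thesis
        using that[of 1 2 3 c d e] rest[of c d e] s tri_same(1) by (simp add: tri_def insert_commute)
    qed
  next
    case (tri_split b c e f)
    have s: "{1, 2, b, c, e, f} = {1..6}"
      using tri_split(2) by (simp add: insert_commute)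
    then have "3 \<in> {1, 2, b, c, e, f}"
      by simp
    then consider "b = 3" | "c = 3" | "e = 3" | "f = 3"
      by auto
    then show thesis
    proof cases
      case 1
      then show thesis
        using that[of 1 3 2 c e f] rest[of c e f] s tri_split(1) by (simp add: tri_def insert_commute)
    next
      case 2
      then show thesis
        using that[of 1 3 2 b e f] rest[of b e f] s tri_split(1) by (simp add: tri_def insert_commute)
    next
      case 3
      then show thesis
        using that[of 2 3 1 f b c] rest[of f b c] s tri_split(1) by (simp add: tri_def insert_commute)
    next
      case 4
      then show thesis
        using that[of 2 3 1 e b c] rest[of e b c] s tri_split(1) by (simp add: tri_def insert_commute)
    qed
  next
    case (cyc_same c d e f)
    have s: "{1, 2, c, d, e, f} = {1..6}"
      using cyc_same(2) by (simp add: insert_commute)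
    then have "3 \<in> {1, 2, c, d, e, f}"
      by simp
    then consider "c = 3" | "d = 3" | "e = 3" | "f = 3"
      by auto
    then show thesis
    proof cases
      case 1
      then show thesis
        using that[of 1 2 3 d e f] rest[of d e f] s cyc_same(1) by (simp add: cyc_def insert_commute)
    next
      case 2
      then show thesis
        using that[of 1 2 3 c e f] rest[of c e f] s cyc_same(1) by (simp add: cyc_def insert_commute)
    next
      case 3
      then show thesis
        using that[of 1 2 3 f c d] rest[of f c d] s cyc_same(1) by (simp add: cyc_def insert_commute)
    next
      case 4
      then show thesis
        using that[of 1 2 3 e c d] rest[of e c d] s cyc_same(1) by (simp add: cyc_def insert_commute)
    qed
  next
    case (cyc_next b d e f)
    have s: "{1, 2, b, d, e, f} = {1..6}"
      using cyc_next(2) by (simp add: insert_commute)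
    then have "3 \<in> {1, 2, b, d, e, f}"
      by simp
    then consider "b = 3" | "d = 3" | "e = 3" | "f = 3"
      by auto
    then show thesis
    proof cases
      case 1
      then show thesis
        using that[of 1 3 2 d e f] rest[of d e f] s cyc_next(1) by (simp add: cyc_def insert_commute)
    next
      case 2
      then show thesis
        using that[of 2 3 1 b e f] rest[of b e f] s cyc_next(1) by (simp add: cyc_def insert_commute)
    next
      case 3
      then show thesis
        using that[of 1 2 3 b d f] rest[of b d f] s cyc_next(1) by (simp add: cyc_def insert_commute)
    next
      case 4
      then show thesis
        using that[of 1 2 3 b d e] rest[of b d e] s cyc_next(1) by (simp add: cyc_def insert_commute)
    qed
  next
    case (cyc_prev b c d f)
    have s: "{1, 2, b, c, d, f} = {1..6}"
      using cyc_prev(2) by (simp add: insert_commute)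
    then have "3 \<in> {1, 2, b, c, d, f}"
      by simp
    then consider "b = 3" | "c = 3" | "d = 3" | "f = 3"
      by auto
    then show thesis
    proof cases
      case 1
      then show thesis
        using that[of 1 3 2 f c d] rest[of f c d] s cyc_prev(1) by (simp add: cyc_def insert_commute)
    next
      case 2
      then show thesis
        using that[of 1 3 2 b d f] rest[of b d f] s cyc_prev(1) by (simp add: cyc_def insert_commute)
    next
      case 3
      then show thesis
        using that[of 1 3 2 b c f] rest[of b c f] s cyc_prev(1) by (simp add: cyc_def insert_commute)
    next
      case 4
      then show thesis
        using that[of 2 3 1 b c d] rest[of b c d] s cyc_prev(1) by (simp add: cyc_def insert_commute)
    qed
  qed
qed

text \<open>
  One equation for every orbit of \<open>S\<^sub>3 \<times> S\<^sub>3\<close> on supports.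
\<close>
lemma support_act_cremona:
  assumes abc: "{a, b, c} = {1, 2, 3}" and def: "{d, e, f} = {4, 5, 6}"
  shows "support_act 6 {a, b} = {a, b}" "support_act 6 {d, e} = {d, e}"
    "support_act 6 {a, d} = {b, c, d}" "support_act 6 {a, b, d} = {c, d}"
    "support_act 6 {a, d, e} = {a, d, e}" "support_act 6 {a, b, c} = {a, b, c}"
    "support_act 6 {d, e, f} = {1..6}" "support_act 6 {1..6} = {d, e, f}"
proof -
  have six: "{1..6} = {a, b, c, d, e, f}"
  proof -
    have "{1..6} = {1, 2, 3} \<union> {4, 5, 6::nat}"
      by auto
    also have "\<dots> = {a, b, c, d, e, f}"
      unfolding abc[symmetric] def[symmetric] by blast
    finally show ?thesis .
  qed
  have d: "distinct [a, b, c, d, e, f]" "distinct [f, e, d, c, b, a]"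
    using distinct_if_six[OF six[symmetric]] by auto
  have act: "support_act 6 S =
    (let T = (S - {a, b, c}) \<union> ({a, b, c} - S) in if T \<subseteq> {a, b, c, d, e, f} \<and> card T \<in> {2, 3, 6} then T else S)" for S
    by (simp add: support_act_def root_supports_def abc six[symmetric] del: One_nat_def)
  show "support_act 6 {a, b} = {a, b}" "support_act 6 {d, e} = {d, e}"
    "support_act 6 {a, d} = {b, c, d}" "support_act 6 {a, b, d} = {c, d}"
    "support_act 6 {a, d, e} = {a, d, e}" "support_act 6 {a, b, c} = {a, b, c}"
    "support_act 6 {d, e, f} = {1..6}" "support_act 6 {1..6} = {d, e, f}"
    unfolding act six using d by (simp_all add: Let_def insert_Diff_if insert_commute)
qed

text \<open>
  The transformation fixes \<open>(abc,def)\<close> and \<open>(ab,ef,cd)\<close>, exchanges \<open>(abd,cef)\<close> with \<open>(ab,cd,ef)\<close>, and sends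
  \<open>(ad,be,cf)\<close> to \<open>(af,ce,bd)\<close>, where \<open>{a,b,c} = {1,2,3}\<close> and \<open>{d,e,f} = {4,5,6}\<close>.  In each case the factor
  \<open>W\<^sup>2\<close> clears the denominators of the transformed minors, and the minors that are left over complete
  the polynomial of the image label.
\<close>
lemma cremona_step:
  assumes x: "x \<in> M" and \<alpha>: "\<alpha> \<in> labels"
  shows "gen_perm 6 (Pos \<alpha>) \<in> coords \<and> y_poly (gen_perm 6 (Pos \<alpha>)) (mat_of x) =
    multiplier 6 x * y_poly (Pos \<alpha>) (mat_of (s_map 6 x))"
proof -
  obtain a b c d e f where abc: "{a, b, c} = {1, 2, 3}" and def: "{d, e, f} = {4, 5, 6}"
    and form: "\<alpha> \<in> {tri a b c d e f, tri a b d c e f, cyc a b c d e f, cyc a b e f c d, cyc a d b e c f}"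
    using label_cases_cremona[OF \<alpha>] .
  have perms: "{a, c, b} = {1, 2, 3}" "{b, c, a} = {1, 2, 3}" "{b, a, c} = {1, 2, 3}" "{c, a, b} = {1, 2, 3}" "{c, b, a} = {1, 2, 3}"
    "{e, d, f} = {4, 5, 6}" "{f, d, e} = {4, 5, 6}" "{d, f, e} = {4, 5, 6}" "{e, f, d} = {4, 5, 6}" "{f, e, d} = {4, 5, 6}"
    using abc def by (simp_all add: insert_commute)
  have "{1..6} = {1, 2, 3} \<union> {4, 5, 6::nat}"
    by auto
  then have six: "{a, b, c, d, e, f} = {1..6}" "{a, b, d, c, e, f} = {1..6}" "{a, b, e, f, c, d} = {1..6}"
    "{a, d, b, e, c, f} = {1..6}" "{a, f, c, e, b, d} = {1..6}"
    unfolding abc[symmetric] def[symmetric] by (simp_all only:) blast+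
  have dist: "distinct [a, b, c, d, e, f]" "distinct [f, e, d, c, b, a]"
    using distinct_if_six[OF six(1)] by auto
  define m where "m S = minor S (mat_of x)" for S
  define m' where "m' S = minor S (mat_of (s_map 6 x))" for S
  define W where "W = cremona_weight x"
  note C = cremona_minors[OF x, folded m_def m'_def W_def]
  have two: "m' {a, b, d} = 1 / m {a, b, d}" "m' {a, b, e} = 1 / m {a, b, e}" "m' {a, b, f} = 1 / m {a, b, f}"
    "m' {a, c, d} = 1 / m {a, c, d}" "m' {a, c, e} = 1 / m {a, c, e}" "m' {a, c, f} = 1 / m {a, c, f}"
    "m' {b, c, d} = 1 / m {b, c, d}" "m' {b, c, e} = 1 / m {b, c, e}" "m' {b, c, f} = 1 / m {b, c, f}"
    using C(1) abc def perms by blast+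
  have nz: "m {a, b, d} \<noteq> 0" "m {a, b, e} \<noteq> 0" "m {a, b, f} \<noteq> 0"
    "m {a, c, d} \<noteq> 0" "m {a, c, e} \<noteq> 0" "m {a, c, f} \<noteq> 0"
    "m {b, c, d} \<noteq> 0" "m {b, c, e} \<noteq> 0" "m {b, c, f} \<noteq> 0"
    using C(8) abc def perms by blast+
  have one:
    "m' {a, d, e} = - m {a, d, e} / (m {a, b, d} * m {a, b, e} * m {a, c, d} * m {a, c, e})"
    "m' {a, d, f} = - m {a, d, f} / (m {a, b, d} * m {a, b, f} * m {a, c, d} * m {a, c, f})"
    "m' {a, e, f} = - m {a, e, f} / (m {a, b, e} * m {a, b, f} * m {a, c, e} * m {a, c, f})"
    "m' {b, d, e} = - m {b, d, e} / (m {a, b, d} * m {a, b, e} * m {b, c, d} * m {b, c, e})"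
    "m' {b, d, f} = - m {b, d, f} / (m {a, b, d} * m {a, b, f} * m {b, c, d} * m {b, c, f})"
    "m' {b, e, f} = - m {b, e, f} / (m {a, b, e} * m {a, b, f} * m {b, c, e} * m {b, c, f})"
    "m' {c, d, e} = - m {c, d, e} / (m {a, c, d} * m {a, c, e} * m {b, c, d} * m {b, c, e})"
    "m' {c, d, f} = - m {c, d, f} / (m {a, c, d} * m {a, c, f} * m {b, c, d} * m {b, c, f})"
    "m' {c, e, f} = - m {c, e, f} / (m {a, c, e} * m {a, c, f} * m {b, c, e} * m {b, c, f})"
    using C(2)[OF abc def] C(2)[OF abc perms(8)] C(2)[OF abc perms(9)] C(2)[OF perms(3) def] C(2)[OF perms(3) perms(8)] C(2)[OF perms(3) perms(9)] C(2)[OF perms(4) def] C(2)[OF perms(4) perms(8)] C(2)[OF perms(4) perms(9)]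
    by (simp_all add: insert_commute)
  note W = C(7)[OF abc def]
  have "W \<noteq> 0"
    using nz by (simp add: W)
  note other = C(3,4)[OF abc def] C(5,6)[OF abc def]
  have mult: "multiplier 6 x = W\<^sup>2"
    by (simp add: multiplier_def W_def)
  note sact = support_act_cremona(6,7,8)[OF abc def]
    support_act_cremona(1)[OF abc def]
    support_act_cremona(1)[OF perms(1) def]
    support_act_cremona(1)[OF perms(2) def]
    support_act_cremona(2)[OF abc def]
    support_act_cremona(2)[OF abc perms(8)]
    support_act_cremona(2)[OF abc perms(9)]
    support_act_cremona(3)[OF abc def]
    support_act_cremona(3)[OF abc perms(6)]
    support_act_cremona(3)[OF abc perms(7)]
    support_act_cremona(3)[OF perms(3) def]
    support_act_cremona(3)[OF perms(3) perms(6)]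
    support_act_cremona(3)[OF perms(3) perms(7)]
    support_act_cremona(3)[OF perms(4) def]
    support_act_cremona(3)[OF perms(4) perms(6)]
    support_act_cremona(3)[OF perms(4) perms(7)]
    support_act_cremona(4)[OF abc def]
    support_act_cremona(4)[OF abc perms(6)]
    support_act_cremona(4)[OF abc perms(7)]
    support_act_cremona(4)[OF perms(1) def]
    support_act_cremona(4)[OF perms(1) perms(6)]
    support_act_cremona(4)[OF perms(1) perms(7)]
    support_act_cremona(4)[OF perms(2) def]
    support_act_cremona(4)[OF perms(2) perms(6)]
    support_act_cremona(4)[OF perms(2) perms(7)]
    support_act_cremona(5)[OF abc def]
    support_act_cremona(5)[OF abc perms(8)]
    support_act_cremona(5)[OF abc perms(9)]
    support_act_cremona(5)[OF perms(3) def]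
    support_act_cremona(5)[OF perms(3) perms(8)]
    support_act_cremona(5)[OF perms(3) perms(9)]
    support_act_cremona(5)[OF perms(4) def]
    support_act_cremona(5)[OF perms(4) perms(8)]
    support_act_cremona(5)[OF perms(4) perms(9)]
  show ?thesis
    using form
  proof (elim insertE emptyE)
    assume \<alpha>_eq: "\<alpha> = tri a b c d e f"
    have "label_act (s_refl 6) \<alpha> = \<alpha>"
      by (rule label_act_eqI[OF _ \<alpha> \<alpha>])
        (simp_all add: \<alpha>_eq label_supports_tri[OF six(1)] sact insert_commute del: One_nat_def)
    moreover have "y_lab \<alpha> (mat_of x) = multiplier 6 x * y_lab \<alpha> (mat_of (s_map 6 x))"
      unfolding \<alpha>_eq y_lab_tri[OF six(1)] mult m_def[symmetric] m'_def[symmetric]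
      using two one other nz \<open>W \<noteq> 0\<close> W
      by (simp add: insert_commute) (simp add: field_simps power2_eq_square)?
    ultimately show ?thesis
      by (rule gen_perm_fixed[OF \<alpha>])
  next
    assume \<alpha>_eq: "\<alpha> = tri a b d c e f"
    have "label_act (s_refl 6) \<alpha> = cyc a b c d e f"
      by (rule label_act_eqI[OF _ \<alpha> cyc_in_labels[OF six(1)]])
        (simp_all add: \<alpha>_eq label_supports_tri[OF six(2)] label_supports_cyc sact insert_commute del: One_nat_def)
    moreover have "cyc a b c d e f \<noteq> \<alpha>" unfolding \<alpha>_eq by (simp add: tri_def cyc_def)
    moreover have "y_lab (cyc a b c d e f) (mat_of x) = - (multiplier 6 x * y_lab \<alpha> (mat_of (s_map 6 x)))"
      unfolding \<alpha>_eq y_lab_tri[OF six(2)] y_lab_cyc[OF six(1)] mult m_def[symmetric] m'_def[symmetric]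
      using two one other nz \<open>W \<noteq> 0\<close> W
      by (simp add: insert_commute) (simp add: field_simps power2_eq_square)?
    ultimately show ?thesis
      by (rule gen_perm_moved[OF cyc_in_labels[OF six(1)]])
  next
    assume \<alpha>_eq: "\<alpha> = cyc a b c d e f"
    have "label_act (s_refl 6) \<alpha> = tri a b d c e f"
      by (rule label_act_eqI[OF _ \<alpha> tri_in_labels[OF six(2)]])
        (simp_all add: \<alpha>_eq label_supports_cyc label_supports_tri[OF six(2)] sact insert_commute del: One_nat_def)
    moreover have "tri a b d c e f \<noteq> \<alpha>" unfolding \<alpha>_eq by (simp add: tri_def cyc_def)
    moreover have "y_lab (tri a b d c e f) (mat_of x) = - (multiplier 6 x * y_lab \<alpha> (mat_of (s_map 6 x)))"
      unfolding \<alpha>_eq y_lab_cyc[OF six(1)] y_lab_tri[OF six(2)] mult m_def[symmetric] m'_def[symmetric]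
      using two one other nz \<open>W \<noteq> 0\<close> W
      by (simp add: insert_commute) (simp add: field_simps power2_eq_square)?
    ultimately show ?thesis
      by (rule gen_perm_moved[OF tri_in_labels[OF six(2)]])
  next
    assume \<alpha>_eq: "\<alpha> = cyc a b e f c d"
    have "label_act (s_refl 6) \<alpha> = \<alpha>"
      by (rule label_act_eqI[OF _ \<alpha> \<alpha>])
        (simp_all add: \<alpha>_eq label_supports_cyc sact insert_commute del: One_nat_def)
    moreover have "y_lab \<alpha> (mat_of x) = multiplier 6 x * y_lab \<alpha> (mat_of (s_map 6 x))"
      unfolding \<alpha>_eq y_lab_cyc[OF six(3)] mult m_def[symmetric] m'_def[symmetric]
      using two one other nz \<open>W \<noteq> 0\<close> W
      by (simp add: insert_commute) (simp add: field_simps power2_eq_square)?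
    ultimately show ?thesis
      by (rule gen_perm_fixed[OF \<alpha>])
  next
    assume \<alpha>_eq: "\<alpha> = cyc a d b e c f"
    have "label_act (s_refl 6) \<alpha> = cyc a f c e b d"
      by (rule label_act_eqI[OF _ \<alpha> cyc_in_labels[OF six(5)]])
        (simp_all add: \<alpha>_eq label_supports_cyc  sact insert_commute del: One_nat_def)
    moreover have "cyc a f c e b d \<noteq> \<alpha>"
    proof
      assume "cyc a f c e b d = \<alpha>"
      then have "({a, f}, {c, e}) \<in> {({a, d}, {b, e}), ({b, e}, {c, f}), ({c, f}, {a, d})}"
        unfolding \<alpha>_eq cyc_def label.inject by (metis insertI1)
      then show False
        using dist by (simp add: doubleton_eq_iff)
    qed
    moreover have "y_lab (cyc a f c e b d) (mat_of x) = - (multiplier 6 x * y_lab \<alpha> (mat_of (s_map 6 x)))"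
      unfolding \<alpha>_eq y_lab_cyc[OF six(4)] y_lab_cyc[OF six(5)] mult m_def[symmetric] m'_def[symmetric]
      using two one other nz \<open>W \<noteq> 0\<close> W
      by (simp add: insert_commute) (simp add: field_simps power2_eq_square)?
    ultimately show ?thesis
      by (rule gen_perm_moved[OF cyc_in_labels[OF six(5)]])
  qed
qed


section \<open>Rational functions on the moduli space\<close>

lemma rational_const: "rational_function_on_M (\<lambda>x. c)"
  unfolding rational_function_on_M_def
  by (intro exI[of _ "\<lambda>x. c"] exI[of _ "\<lambda>x. 1"]) (simp add: complex_polynomial_function.const)

lemma rational_coordinate: "rational_function_on_M (\<lambda>x. x $ i)"
  unfolding rational_function_on_M_def
  by (intro exI[of _ "\<lambda>x. x $ i"] exI[of _ "\<lambda>x. 1"])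
    (simp add: complex_polynomial_function.const complex_polynomial_function.coordinate)

lemma rational_add:
  assumes "rational_function_on_M f" "rational_function_on_M g"
  shows "rational_function_on_M (\<lambda>x. f x + g x)"
proof -
  obtain p q p' q' where *: "complex_polynomial_function p" "complex_polynomial_function q"
    "complex_polynomial_function p'" "complex_polynomial_function q'"
    "\<And>x. x \<in> M \<Longrightarrow> q x \<noteq> 0 \<and> f x = p x / q x" "\<And>x. x \<in> M \<Longrightarrow> q' x \<noteq> 0 \<and> g x = p' x / q' x"
    using assms unfolding rational_function_on_M_def by metis
  have "complex_polynomial_function (\<lambda>x. p x * q' x + p' x * q x)" "complex_polynomial_function (\<lambda>x. q x * q' x)"
    using * by (auto intro!: complex_polynomial_function.add complex_polynomial_function.mult)
  moreover have "q x * q' x \<noteq> 0 \<and> f x + g x = (p x * q' x + p' x * q x) / (q x * q' x)" if "x \<in> M" for x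
    using *(5,6)[OF that] by (simp add: add_frac_eq)
  ultimately show ?thesis
    unfolding rational_function_on_M_def by blast
qed

lemma rational_mult:
  assumes "rational_function_on_M f" "rational_function_on_M g"
  shows "rational_function_on_M (\<lambda>x. f x * g x)"
proof -
  obtain p q p' q' where *: "complex_polynomial_function p" "complex_polynomial_function q"
    "complex_polynomial_function p'" "complex_polynomial_function q'"
    "\<And>x. x \<in> M \<Longrightarrow> q x \<noteq> 0 \<and> f x = p x / q x" "\<And>x. x \<in> M \<Longrightarrow> q' x \<noteq> 0 \<and> g x = p' x / q' x"
    using assms unfolding rational_function_on_M_def by metis
  have "complex_polynomial_function (\<lambda>x. p x * p' x)" "complex_polynomial_function (\<lambda>x. q x * q' x)"
    using * by (auto intro!: complex_polynomial_function.mult)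
  moreover have "q x * q' x \<noteq> 0 \<and> f x * g x = (p x * p' x) / (q x * q' x)" if "x \<in> M" for x
    using *(5,6)[OF that] by simp
  ultimately show ?thesis
    unfolding rational_function_on_M_def by blast
qed

lemma rational_inverse:
  assumes "rational_function_on_M f" "\<And>x. x \<in> M \<Longrightarrow> f x \<noteq> 0"
  shows "rational_function_on_M (\<lambda>x. 1 / f x)"
proof -
  obtain p q where *: "complex_polynomial_function p" "complex_polynomial_function q"
    "\<And>x. x \<in> M \<Longrightarrow> q x \<noteq> 0 \<and> f x = p x / q x"
    using assms(1) unfolding rational_function_on_M_def by metis
  have "p x \<noteq> 0 \<and> 1 / f x = q x / p x" if "x \<in> M" for x
    using *(3)[OF that] assms(2)[OF that] by simp
  then show ?thesis
    unfolding rational_function_on_M_def using *(1,2) by blast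
qed

lemma rational_divide:
  assumes "rational_function_on_M f" "rational_function_on_M g" "\<And>x. x \<in> M \<Longrightarrow> g x \<noteq> 0"
  shows "rational_function_on_M (\<lambda>x. f x / g x)"
  using rational_mult[OF assms(1) rational_inverse[OF assms(2,3)]] by simp

lemma rational_diff:
  assumes "rational_function_on_M f" "rational_function_on_M g"
  shows "rational_function_on_M (\<lambda>x. f x - g x)"
  using rational_add[OF assms(1) rational_mult[OF rational_const[of "-1"] assms(2)]] by simp

lemma rational_power:
  "rational_function_on_M f \<Longrightarrow> rational_function_on_M (\<lambda>x. f x ^ n)"
  by (induction n) (auto intro: rational_const rational_mult)

lemma rational_prod:
  "(\<And>i. i \<in> I \<Longrightarrow> rational_function_on_M (f i)) \<Longrightarrow> rational_function_on_M (\<lambda>x. \<Prod>i\<in>I. f i x)"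
  by (induction I rule: infinite_finite_induct) (auto intro: rational_const rational_mult)

lemma rational_cong:
  assumes "rational_function_on_M f" "\<And>x. x \<in> M \<Longrightarrow> f x = g x"
  shows "rational_function_on_M g"
  using assms unfolding rational_function_on_M_def by metis

text \<open>
  The denominator of \<open>c\<close> vanishes nowhere on \<open>M\<close>, and \<open>F\<close> maps \<open>M\<close> to itself, so no pole arises on \<open>M\<close>.
\<close>
lemma rational_compose:
  assumes "rational_function_on_M c" "F \<in> M \<rightarrow> M" "\<And>i. rational_function_on_M (\<lambda>x. F x $ i)"
  shows "rational_function_on_M (\<lambda>x. c (F x))"
proof -
  have poly: "rational_function_on_M (\<lambda>x. p (F x))" if "complex_polynomial_function p" for p
    using that by induction (auto intro: assms(3) rational_const rational_add rational_mult)
  obtain p q where *: "complex_polynomial_function p" "complex_polynomial_function q"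
    "\<And>x. x \<in> M \<Longrightarrow> q x \<noteq> 0 \<and> c x = p x / q x"
    using assms(1) unfolding rational_function_on_M_def by metis
  have FM: "F x \<in> M" if "x \<in> M" for x
    using assms(2) that by blast
  have "rational_function_on_M (\<lambda>x. p (F x) / q (F x))"
    by (rule rational_divide) (use * FM in \<open>auto intro: poly\<close>)
  then show ?thesis
    by (rule rational_cong) (use * FM in auto)
qed

lemma rational_if:
  assumes "P \<Longrightarrow> rational_function_on_M f" "\<not> P \<Longrightarrow> rational_function_on_M g"
  shows "rational_function_on_M (\<lambda>x. if P then f x else g x)"
  using assms by (cases P) simp_all

lemmas rational_intros = rational_if rational_const rational_coordinate rational_add rational_mult rational_diff
  rational_divide rational_power rational_prod

lemma rational_s_map: "rational_function_on_M (\<lambda>x. s_map k x $ i)"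
proof -
  have nz: "x $ 1 \<noteq> 0" "x $ 2 \<noteq> 0" "x $ 3 \<noteq> 0" "x $ 4 \<noteq> 0" "x $ 3 \<noteq> 1" "x $ 4 \<noteq> 1" "1 \<noteq> x $ 3" "1 \<noteq> x $ 4"
    if "x \<in> M" for x
    using M_nonzero[OF that] by auto
  have "\<forall>i. rational_function_on_M (\<lambda>x. s_map k x $ i)"
    unfolding forall_4 s_map_def
    by (cases "k = 1"; cases "k = 2"; cases "k = 3"; cases "k = 4"; cases "k = 5")
      (simp_all add: vector_4 rational_intros nz del: One_nat_def)
  then show ?thesis ..
qed

lemma multiplier_nonzero: "x \<in> M \<Longrightarrow> multiplier k x \<noteq> 0"
  using scales_nonzero[of x] M_nonzero[of x] by (simp add: multiplier_def cremona_weight_def)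

lemma rational_multiplier: "rational_function_on_M (multiplier k)"
proof -
  have nz: "x $ 1 \<noteq> 0" "x $ 2 \<noteq> 0" "x $ 3 \<noteq> 0" "1 \<noteq> x $ 3" "1 \<noteq> x $ 4"
    if "x \<in> M" for x
    using M_nonzero[OF that] by auto
  have t: "rational_function_on_M (\<lambda>x. column_scale k x i)" for i
    unfolding column_scale_def by (auto intro!: rational_intros simp: nz)
  have D: "rational_function_on_M (row_det k)"
    unfolding row_det_def by (auto intro!: rational_intros simp: nz)
  have W: "rational_function_on_M (\<lambda>x. (cremona_weight x)\<^sup>2)"
    using rational_power[of cremona_weight 2] rational_diff[OF rational_const[of 0], of "\<lambda>x. x$1 * x$2 * x$3 * x$4"]
    by (simp add: cremona_weight_def[abs_def] rational_intros)
  have "rational_function_on_M (\<lambda>x. 1 / (row_det k x ^ 6 * (\<Prod>i\<in>{1..6}. column_scale k x i) ^ 3))"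
    by (intro rational_intros t D) (use scales_nonzero in auto)
  with W show ?thesis
    unfolding multiplier_def by (cases "k = 6") simp_all
qed


section \<open>Equivariance\<close>

lemma generator_step:
  assumes x: "x \<in> M" and k: "k \<in> {1..6}" and \<kappa>: "\<kappa> \<in> coords"
  shows "gen_perm k \<kappa> \<in> coords"
    "y_poly (gen_perm k \<kappa>) (mat_of x) = multiplier k x * y_poly \<kappa> (mat_of (s_map k x))"
proof -
  have "k \<in> {1..5} \<or> k = 6"
    using k by auto
  then have pos: "gen_perm k (Pos \<alpha>) \<in> coords"
      "y_poly (gen_perm k (Pos \<alpha>)) (mat_of x) = multiplier k x * y_poly (Pos \<alpha>) (mat_of (s_map k x))"
    if "\<alpha> \<in> labels" for \<alpha>
    using transposition_step[OF x _ that] cremona_step[OF x that] by blast+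
  have neg: "y_poly (gen_perm k (Neg \<alpha>)) X = - y_poly (gen_perm k (Pos \<alpha>)) X"
    "gen_perm k (Neg \<alpha>) \<in> coords \<longleftrightarrow> gen_perm k (Pos \<alpha>) \<in> coords" for \<alpha> X
    by (auto simp: Let_def coords_def)
  obtain \<alpha> where "\<alpha> \<in> labels" "\<kappa> = Pos \<alpha> \<or> \<kappa> = Neg \<alpha>"
    using \<kappa> by (auto simp: coords_def)
  then show "gen_perm k \<kappa> \<in> coords"
    "y_poly (gen_perm k \<kappa>) (mat_of x) = multiplier k x * y_poly \<kappa> (mat_of (s_map k x))"
    using pos[of \<alpha>] neg[of \<alpha>] by (auto simp del: gen_perm.simps)
qed

text \<open>
  The coordinate of the label \<open>(123,456)\<close> vanishes nowhere on \<open>M\<close>: it is the product of two factors of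
  the discriminant, up to sign.
\<close>
lemma phi_in_P79: "x \<in> M \<Longrightarrow> \<phi> x \<in> P79"
proof -
  assume x: "x \<in> M"
  have six: "{1, 2, 3, 4, 5, 6} = {1..6::nat}"
    by auto
  have "y_poly (Pos (tri 1 2 3 4 5 6)) (mat_of x) = - (D2 x * Q4 x)"
    unfolding y_poly.simps y_lab_tri[OF six] minors_mat_of Q_mat_of by simp
  then have "y_poly (Pos (tri 1 2 3 4 5 6)) (mat_of x) \<noteq> 0"
    using M_nonzero[OF x] by simp
  moreover have "Pos (tri 1 2 3 4 5 6) \<in> coords"
    using tri_in_labels[OF six] by (simp add: coords_def)
  ultimately show "\<phi> x \<in> P79"
    unfolding \<phi>_def P79_def by blast
qed

lemma proj_point_scale:
  assumes "c \<noteq> 0" "\<And>\<kappa>. \<kappa> \<in> coords \<Longrightarrow> v \<kappa> = c * w \<kappa>"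
  shows "proj_point v = proj_point w"
proof -
  have "proj_point v \<subseteq> proj_point w" if "c \<noteq> 0" "\<And>\<kappa>. \<kappa> \<in> coords \<Longrightarrow> v \<kappa> = c * w \<kappa>" for c v w
  proof
    fix u assume "u \<in> proj_point v"
    then obtain b where "b \<noteq> 0" "u = (\<lambda>\<kappa>\<in>coords. b * v \<kappa>)"
      by (auto simp: proj_point_def)
    then have "u = (\<lambda>\<kappa>\<in>coords. (b * c) * w \<kappa>)" "b * c \<noteq> 0"
      using that by (auto simp: fun_eq_iff)
    then show "u \<in> proj_point w"
      unfolding proj_point_def by blast
  qed
  note sub = this
  have "w \<kappa> = (1 / c) * v \<kappa>" if "\<kappa> \<in> coords" for \<kappa>
    using assms that by simp
  then show ?thesis
    using sub[of c v w] sub[of "1 / c" w v] assms by auto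
qed

lemma point_act_proj_point:
  assumes "\<And>\<kappa>. \<kappa> \<in> coords \<Longrightarrow> \<pi> \<kappa> \<in> coords"
  shows "point_act \<pi> (proj_point v) = proj_point (v \<circ> \<pi>)"
proof -
  have "(\<lambda>\<kappa>\<in>coords. (\<lambda>\<kappa>\<in>coords. c * v \<kappa>) (\<pi> \<kappa>)) = (\<lambda>\<kappa>\<in>coords. c * (v \<circ> \<pi>) \<kappa>)" for c
    using assms by (auto simp: fun_eq_iff)
  moreover have "proj_point w = (\<lambda>c. \<lambda>\<kappa>\<in>coords. c * w \<kappa>) ` {c. c \<noteq> 0}" for w
    unfolding proj_point_def by blast
  ultimately show ?thesis
    unfolding point_act_def by (simp add: image_image)
qed

text \<open>
  The factors compose as a cocycle: from \<open>c\<^sub>g\<close> and the generator \<open>s\<^sub>k\<close> one gets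
  \<open>c x \<cdot> multiplier k (\<iota> g x)\<close> for \<open>s\<^sub>k g\<close>, as \<open>\<iota>\<close> is a homomorphism and sends \<open>s\<^sub>k\<close> to \<open>s_map k\<close> on \<open>M\<close>.
  Rationality of this product needs that \<open>\<iota> g\<close> is a rational map, and substituting \<open>\<iota> g x\<close> in the
  identity for the generator needs that \<open>\<iota> g\<close> preserves \<open>M\<close>; so both are carried along in the induction.
\<close>
lemma acts_by_scales:
  fixes \<iota> :: "(real^8 \<Rightarrow> real^8) \<Rightarrow> (complex^4 \<Rightarrow> complex^4)"
  assumes iso: "\<iota> \<in> iso G G_bar"
    and gens: "\<And>k. k \<in> {1..6} \<Longrightarrow> \<iota> (s_refl k) = s_bar k"
    and "acts_by g \<pi>"
  shows "g \<in> carrier G \<and> \<iota> g \<in> M \<rightarrow> M \<and> (\<forall>i. rational_function_on_M (\<lambda>x. \<iota> g x $ i)) \<and>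
    (\<exists>c. rational_function_on_M c \<and> (\<forall>x\<in>M. c x \<noteq> 0 \<and> (\<forall>\<kappa>\<in>coords. \<pi> \<kappa> \<in> coords \<and>
       y_poly (\<pi> \<kappa>) (mat_of x) = c x * y_poly \<kappa> (mat_of (\<iota> g x)))))"
  using assms(3)
proof induction
  interpret G: group G
    unfolding G_def by (simp add: group.group_subgroup_generated group_BijGroup)
  interpret G_bar: group G_bar
    unfolding G_bar_def by (simp add: group.group_subgroup_generated group_BijGroup)
  have hom: "\<iota> \<in> hom G G_bar"
    using iso by (simp add: iso_def)
  {
    case one
    have "\<iota> \<one>\<^bsub>G\<^esub> = \<one>\<^bsub>G_bar\<^esub>"
      using hom_one[OF hom G.group_axioms G_bar.group_axioms] .
    then have id: "\<iota> \<one>\<^bsub>G\<^esub> x = x" if "x \<in> M" for x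
      using that by (simp add: G_bar_def BijGroup_def)
    have "rational_function_on_M (\<lambda>x. \<iota> \<one>\<^bsub>G\<^esub> x $ i)" for i
      by (rule rational_cong[OF rational_coordinate]) (simp add: id)
    then show ?case
      using id rational_const[of 1] by (auto intro!: exI[of _ "\<lambda>x. 1"])
  next
    case (gen g \<pi> k)
    then obtain c where g: "g \<in> carrier G" "\<iota> g \<in> M \<rightarrow> M" "\<And>i. rational_function_on_M (\<lambda>x. \<iota> g x $ i)"
      and c: "rational_function_on_M c" "\<And>x. x \<in> M \<Longrightarrow> c x \<noteq> 0"
        "\<And>x \<kappa>. x \<in> M \<Longrightarrow> \<kappa> \<in> coords \<Longrightarrow> \<pi> \<kappa> \<in> coords"
        "\<And>x \<kappa>. x \<in> M \<Longrightarrow> \<kappa> \<in> coords \<Longrightarrow> y_poly (\<pi> \<kappa>) (mat_of x) = c x * y_poly \<kappa> (mat_of (\<iota> g x))"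
      by blast
    let ?h = "s_refl k \<otimes>\<^bsub>G\<^esub> g"
    have Bij: "f \<in> Bij M" if "f \<in> carrier G_bar" for f
      using that group.carrier_subgroup_generated_subset[OF group_BijGroup[of M]]
      by (auto simp: G_bar_def BijGroup_def)
    have closed: "s_bar k \<in> carrier G_bar" "\<iota> g \<in> carrier G_bar"
      using hom_in_carrier[OF hom s_refl_closed[OF gen.hyps(2)]] hom_in_carrier[OF hom g(1)]
        gens[OF gen.hyps(2)] by simp_all
    have "\<iota> ?h = s_bar k \<otimes>\<^bsub>G_bar\<^esub> \<iota> g"
      using hom_mult[OF hom s_refl_closed[OF gen.hyps(2)] g(1)] gens[OF gen.hyps(2)] by simp
    then have h: "\<iota> ?h x = s_map k (\<iota> g x)" if "x \<in> M" for x
      using closed[THEN Bij] g(2) that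
      by (auto simp: G_bar_def BijGroup_def compose_def s_bar_def)
    \<comment> \<open>Membership of \<open>\<iota> (s_refl k)\<close> in the carrier says that \<open>s_map k\<close> is a bijection of \<open>M\<close>.\<close>
    have sM: "s_map k x \<in> M" if "x \<in> M" for x
      using Bij[OF closed(1)] that by (auto simp: Bij_def bij_betw_def s_bar_def)
    have gM: "\<iota> g x \<in> M" if "x \<in> M" for x
      using g(2) that by blast
    have r1: "rational_function_on_M (\<lambda>x. \<iota> ?h x $ i)" for i
      by (rule rational_cong[OF rational_compose[OF rational_s_map[of k i] g(2,3)]]) (simp add: h)
    have r2: "rational_function_on_M (\<lambda>x. c x * multiplier k (\<iota> g x))"
      by (intro rational_mult c(1) rational_compose[OF rational_multiplier g(2,3)])
    have y: "y_poly ((\<pi> \<circ> gen_perm k) \<kappa>) (mat_of x) =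
        (c x * multiplier k (\<iota> g x)) * y_poly \<kappa> (mat_of (\<iota> ?h x))" "(\<pi> \<circ> gen_perm k) \<kappa> \<in> coords"
      if "x \<in> M" "\<kappa> \<in> coords" for x \<kappa>
      using generator_step[OF gM[OF that(1)] gen.hyps(2) that(2)] c(3,4)[OF that(1)] h[OF that(1)] by simp_all
    show ?case
    proof (intro conjI allI ballI exI[of _ "\<lambda>x. c x * multiplier k (\<iota> g x)"])
      show "?h \<in> carrier G"
        using G.m_closed[OF s_refl_closed[OF gen.hyps(2)] g(1)] .
      show "\<iota> ?h \<in> M \<rightarrow> M"
        using h sM gM by simp
      show "c x * multiplier k (\<iota> g x) \<noteq> 0" if "x \<in> M" for x
        using c(2) multiplier_nonzero gM that by simp
    qed (fact r1 r2 y)+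
  }
qed

theorem theorem1:
  fixes \<iota> :: "(real^8 \<Rightarrow> real^8) \<Rightarrow> (complex^4 \<Rightarrow> complex^4)"
  assumes iso: "\<iota> \<in> iso G G_bar"
    and gens: "\<And>k. k \<in> {1..6} \<Longrightarrow> \<iota> (s_refl k) = s_bar k"
  shows "\<phi> \<in> M \<rightarrow> P79 \<and>
    (\<forall>g\<in>carrier G. \<forall>\<pi>. acts_by g \<pi> \<longrightarrow>
       (\<forall>x\<in>M. point_act \<pi> (\<phi> x) = \<phi> (\<iota> g x)) \<and>
       (\<exists>c. rational_function_on_M c \<and>
          (\<forall>\<kappa>\<in>coords. \<forall>x\<in>M.
             y_poly (\<pi> \<kappa>) (mat_of x) = c x * y_poly \<kappa> (mat_of (\<iota> g x)))))"
proof (intro conjI ballI allI impI)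
  show "\<phi> \<in> M \<rightarrow> P79"
    using phi_in_P79 by blast
next
  fix g \<pi> assume acts: "acts_by g \<pi>"
  have "\<exists>c. rational_function_on_M c \<and> (\<forall>x\<in>M. c x \<noteq> 0 \<and> (\<forall>\<kappa>\<in>coords. \<pi> \<kappa> \<in> coords \<and>
      y_poly (\<pi> \<kappa>) (mat_of x) = c x * y_poly \<kappa> (mat_of (\<iota> g x))))"
    using acts_by_scales[OF iso _ acts] gens by simp
  then obtain c where c: "rational_function_on_M c" "\<And>x. x \<in> M \<Longrightarrow> c x \<noteq> 0"
    "\<And>x \<kappa>. x \<in> M \<Longrightarrow> \<kappa> \<in> coords \<Longrightarrow> \<pi> \<kappa> \<in> coords"
    "\<And>x \<kappa>. x \<in> M \<Longrightarrow> \<kappa> \<in> coords \<Longrightarrow> y_poly (\<pi> \<kappa>) (mat_of x) = c x * y_poly \<kappa> (mat_of (\<iota> g x))"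
    by blast
  then show "\<exists>c. rational_function_on_M c \<and> (\<forall>\<kappa>\<in>coords. \<forall>x\<in>M.
      y_poly (\<pi> \<kappa>) (mat_of x) = c x * y_poly \<kappa> (mat_of (\<iota> g x)))"
    by blast
  fix x assume x: "x \<in> M"
  have "point_act \<pi> (\<phi> x) = proj_point ((\<lambda>\<kappa>. y_poly \<kappa> (mat_of x)) \<circ> \<pi>)"
    unfolding \<phi>_def using c(3)[OF x] by (rule point_act_proj_point)
  also have "\<dots> = \<phi> (\<iota> g x)"
    unfolding \<phi>_def using c(2,4)[OF x] by (intro proj_point_scale[of "c x"]) simp_all
  finally show "point_act \<pi> (\<phi> x) = \<phi> (\<iota> g x)" .
qed

end
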